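(* Let $G$ be a rooted directed tree without leaves, with edges $\{e_i : i\in I\}$. Let $1<p<\infty$ and let $\rho=(\rho_i)_{i\in I}$ be a $p$-admissible weight, so that the left translation semigroup $(T_t)_{t\ge 0}$ is a strongly continuous semigroup on $L^p_\rho(L(G))$. Let $\mathcal F$ be a proper, finite invariant Furstenberg family on $\mathbb R_+$. For $i\in I$, $t\ge 0$, $s\in[0,1)$ put $$\Phi_i(t,s)=\Bigl(\sum_{j\in M_{n(t,s)}(i)}\frac{1}{\rho_j(t+s-n(t,s))^{1/(p-1)}}\Bigr)^{1-p},$$ where the sum is taken in $[0,+\infty]$ and $(+\infty)^{1-p}=0$. For a finite nonempty set $K\subset I$, $\varepsilon>0$ and $0<\alpha<1$, define $$\mathcal N(K,\varepsilon,\alpha)=\Bigl\{t\ge 0:\ \inf_{E\subset[0,1),\ m(E)>\alpha}\ \int_E\sum_{i\in K}\Phi_i(t,s)\,ds<\varepsilon\Bigr\},$$ where the infimum is over all Lebesgue measurable subsets $E$ of $[0,1)$ with $m(E)>\alpha$ and $m$ is Lebesgue measure. Then the following assertions are equivalent: (i) $(T_t)_{t\ge0}$ is $\mathcal F$-transitive on $L^p_\rho(L(G))$; (ii) for every finite nonempty set $K\subset I$, every $\varepsilon>0$ and every $0<\alpha<1$, one has $\mathcal N(K,\varepsilon,\alpha)\in\mathcal F$; (iii) $(T_t)_{t\ge0}$ is topologically $\mathcal F$-recurrent on $L^p_\rho(L(G))$.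
   Context: **Directed trees.** A directed tree is a directed graph $G=(V,E)$ that is connected (as an undirected graph), contains no cycles, in which every vertex $v$ has at most one parent (at most one $u\in V$ with $(u,v)\in E$), and with $V$ countable. If $(u,v)\in E$, then $u$ is the parent of $v$ and $v$ a child of $u$; $u$ is the tail and $v$ the head of the edge $(u,v)$. A leaf is a vertex without children, a root is a vertex without a parent; $G$ is rooted if it has a root. Write $E=\{e_i:i\in I\}$ with $I$ countable (distinct indices giving distinct edges). For $i\in I$ let $M_0(i)=\{i\}$ and $M_{n+1}(i)=\{j\in I:\text{the head of } e_k \text{ is the tail of } e_j \text{ for some } k\in M_n(i)\}$, $n\in\mathbb N_0$. **Weighted spaces.** The directed metric tree $L(G)$ is obtained by replacing each edge by a copy of $[0,1)$, with coordinate increasing from tail to head. A function on $L(G)$ is identified with a family $f=(f_i)_{i\in I}$, $f_i:[0,1)\to\mathbb K$, where $\mathbb K=\mathbb R$ or $\mathbb C$. A weight is a family $\rho=(\rho_i)_{i\in I}$ with $\rho_i\in L^1([0,1))$ and $\rho_i(s)>0$ for every $s\in[0,1)$. For $1\le p<\infty$, $L^p_\rho(L(G))$ is the Banach space of (classes of a.e. equal) measurable families $f=(f_i)_{i\in I}$ with norm $\|f\|_{p,\rho}=\bigl(\sum_{i\in I}\int_0^1|f_i(s)|^p\rho_i(s)\,ds\bigr)^{1/p}<\infty$. **Left translation semigroup.** For $t\ge0$, $s\in[0,1)$ set $n(t,s)=\lfloor t+s\rfloor$ and $\sigma(t,s)=t+s-n(t,s)\in[0,1)$. For $t\ge 0$,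 $(T_tf)_i(s)=\sum_{j\in M_{n(t,s)}(i)}f_j(\sigma(t,s))$ for $i\in I$ and a.e. $s\in[0,1)$ (empty sums are $0$). **Admissibility.** For $1<p<\infty$, $\rho$ is $p$-admissible if there exist $M\ge1$ and $\omega\in\mathbb R$ such that for every $i\in I$, $t\ge0$, $s\in[0,1)$: $$\Bigl(\sum_{j\in M_{n(t,s)}(i)}\rho_j(\sigma(t,s))^{-1/(p-1)}\Bigr)^{p-1}\le M^pe^{p\omega t}\frac1{\rho_i(s)}.$$ It is known that if $\rho$ is $p$-admissible, then $(T_t)_{t\ge0}$ is a strongly continuous semigroup of bounded linear operators on $L^p_\rho(L(G))$ with $\|T_t\|\le Me^{\omega t}$. **Furstenberg families.** A Furstenberg family on $\mathbb R_+=[0,\infty)$ is a nonempty collection $\mathcal F$ of subsets of $\mathbb R_+$ such that $A\in\mathcal F$ and $A\subset B\subset\mathbb R_+$ imply $B\in\mathcal F$. It is proper if $\varnothing\notin\mathcal F$ (and $\mathcal F\ne\varnothing$), and finite invariant if $A\in\mathcal F$, $R>0$ imply $A\cap(R,\infty)\in\mathcal F$. For a semigroup $(T_t)_{t\ge0}$ on $X$ and nonempty open $U,V\subset X$, let $N(U,V)=\{t\ge0:T_t(U)\cap V\ne\varnothing\}$. The semigroup is $\mathcal F$-transitive if $N(U,V)\in\mathcal F$ for all nonempty open $U,V\subset X$, and topologically $\mathcal F$-recurrent if $N(U,U)\in\mathcal F$ for every nonempty open $U\subset X$. *)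

theory Defs
  imports "HOL-Analysis.Analysis" "Graph_Theory.Digraph_Component"
begin

section \<open>Directed trees\<close>

text \<open>
  The edges are the family \<open>e\<^sub>i = (tail G i, head G i)\<close>, \<open>i \<in> arcs G\<close>, so \<open>arcs G\<close> is the
  index set \<open>I\<close>; \<^locale>\<open>nomulti_digraph\<close> says that distinct indices give distinct edges.
  \<^const>\<open>tree\<close> asks for connectedness of the underlying undirected graph and for the absence
  of directed cycles (loops included). When every vertex has at most one parent, an
  undirected cycle is automatically a directed one.
\<close>

definition directed_tree :: "('v, 'i) pre_digraph \<Rightarrow> bool" where
  "directed_tree G \<longleftrightarrow>
     nomulti_digraph G \<and> tree G \<and> countable (verts G) \<and>
     (\<forall>u u' v. u \<rightarrow>\<^bsub>G\<^esub> v \<and> u' \<rightarrow>\<^bsub>G\<^esub> v \<longrightarrow> u = u')"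

definition is_root :: "('v, 'i) pre_digraph \<Rightarrow> 'v \<Rightarrow> bool" where
  "is_root G v \<longleftrightarrow> v \<in> verts G \<and> in_arcs G v = {}"

definition is_leaf :: "('v, 'i) pre_digraph \<Rightarrow> 'v \<Rightarrow> bool" where
  "is_leaf G v \<longleftrightarrow> v \<in> verts G \<and> out_arcs G v = {}"

definition rooted :: "('v, 'i) pre_digraph \<Rightarrow> bool" where
  "rooted G \<longleftrightarrow> (\<exists>v. is_root G v)"

definition leafless :: "('v, 'i) pre_digraph \<Rightarrow> bool" where
  "leafless G \<longleftrightarrow> (\<nexists>v. is_leaf G v)"

primrec succ_arcs :: "('v, 'i) pre_digraph \<Rightarrow> nat \<Rightarrow> 'i \<Rightarrow> 'i set" where
  "succ_arcs G 0 i = {i}"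
| "succ_arcs G (Suc n) i = {j \<in> arcs G. \<exists>k \<in> succ_arcs G n i. head G k = tail G j}"


section \<open>Weighted spaces on the metric tree\<close>

definition is_weight :: "('v, 'i) pre_digraph \<Rightarrow> ('i \<Rightarrow> real \<Rightarrow> real) \<Rightarrow> bool" where
  "is_weight G \<rho> \<longleftrightarrow>
     (\<forall>i \<in> arcs G. integrable (lebesgue_on {0..<1}) (\<rho> i) \<and> (\<forall>s \<in> {0..<1}. 0 < \<rho> i s))"

text \<open>
  The scalars are a type \<open>'k :: {real_normed_field, euclidean_space}\<close>. Both \<^typ>\<open>real\<close> and
  \<^typ>\<open>complex\<close> are instances, and up to isometric isomorphism they are the only ones.

  A function on the metric tree is a family \<open>f :: 'i \<Rightarrow> real \<Rightarrow> 'k\<close>; only its values \<open>f i s\<close>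
  with \<open>i \<in> arcs G\<close> and \<open>0 \<le> s < 1\<close> matter, since \<open>Lp_rel\<close> below ignores all others.
\<close>

definition Lp_mass ::
  "('v, 'i) pre_digraph \<Rightarrow> ('i \<Rightarrow> real \<Rightarrow> real) \<Rightarrow> real \<Rightarrow>
   ('i \<Rightarrow> real \<Rightarrow> 'k::{real_normed_field, euclidean_space}) \<Rightarrow> ennreal" where
  "Lp_mass G \<rho> p f =
     (\<Sum>\<^sub>\<infinity>i\<in>arcs G. \<integral>\<^sup>+s. ennreal (norm (f i s) powr p * \<rho> i s) \<partial>lebesgue_on {0..<1})"

definition Lp_fun ::
  "('v, 'i) pre_digraph \<Rightarrow> ('i \<Rightarrow> real \<Rightarrow> real) \<Rightarrow> real \<Rightarrow>
   ('i \<Rightarrow> real \<Rightarrow> 'k::{real_normed_field, euclidean_space}) set" where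
  "Lp_fun G \<rho> p =
     {f. (\<forall>i \<in> arcs G. f i \<in> borel_measurable (lebesgue_on {0..<1})) \<and> Lp_mass G \<rho> p f < \<infinity>}"

definition Lp_norm ::
  "('v, 'i) pre_digraph \<Rightarrow> ('i \<Rightarrow> real \<Rightarrow> real) \<Rightarrow> real \<Rightarrow>
   ('i \<Rightarrow> real \<Rightarrow> 'k::{real_normed_field, euclidean_space}) \<Rightarrow> real" where
  "Lp_norm G \<rho> p f = enn2real (Lp_mass G \<rho> p f) powr (1 / p)"

definition Lp_rel ::
  "('v, 'i) pre_digraph \<Rightarrow> ('i \<Rightarrow> real \<Rightarrow> real) \<Rightarrow> real \<Rightarrow>
   (('i \<Rightarrow> real \<Rightarrow> 'k) \<times> ('i \<Rightarrow> real \<Rightarrow> 'k::{real_normed_field, euclidean_space})) set" where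
  "Lp_rel G \<rho> p =
     {(f, g). f \<in> Lp_fun G \<rho> p \<and> g \<in> Lp_fun G \<rho> p \<and>
        (\<forall>i \<in> arcs G. AE s in lebesgue_on {0..<1}. f i s = g i s)}"

definition Lp_space ::
  "('v, 'i) pre_digraph \<Rightarrow> ('i \<Rightarrow> real \<Rightarrow> real) \<Rightarrow> real \<Rightarrow>
   ('i \<Rightarrow> real \<Rightarrow> 'k::{real_normed_field, euclidean_space}) set set" where
  "Lp_space G \<rho> p = Lp_fun G \<rho> p // Lp_rel G \<rho> p"

text \<open>The distance induced by the norm; it does not depend on the chosen representatives.\<close>

definition Lp_dist ::
  "('v, 'i) pre_digraph \<Rightarrow> ('i \<Rightarrow> real \<Rightarrow> real) \<Rightarrow> real \<Rightarrow>
   ('i \<Rightarrow> real \<Rightarrow> 'k::{real_normed_field, euclidean_space}) set \<Rightarrow> ('i \<Rightarrow> real \<Rightarrow> 'k) set \<Rightarrow> real" where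
  "Lp_dist G \<rho> p X Y = Lp_norm G \<rho> p (\<lambda>i s. (SOME f. f \<in> X) i s - (SOME g. g \<in> Y) i s)"

definition Lp_topology ::
  "('v, 'i) pre_digraph \<Rightarrow> ('i \<Rightarrow> real \<Rightarrow> real) \<Rightarrow> real \<Rightarrow>
   ('i \<Rightarrow> real \<Rightarrow> 'k::{real_normed_field, euclidean_space}) set topology" where
  "Lp_topology G \<rho> p = Metric_space.mtopology (Lp_space G \<rho> p) (Lp_dist G \<rho> p)"


section \<open>The left translation semigroup\<close>

definition shift_n :: "real \<Rightarrow> real \<Rightarrow> nat" where
  "shift_n t s = nat \<lfloor>t + s\<rfloor>"

definition shift_pos :: "real \<Rightarrow> real \<Rightarrow> real" where
  "shift_pos t s = t + s - real (shift_n t s)"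

text \<open>
  The sum may be infinite. For an admissible weight and \<open>f\<close> in \<open>Lp_fun\<close> it converges
  absolutely for almost every \<open>s\<close>; elsewhere \<open>infsum\<close> returns the irrelevant value \<open>0\<close>.
\<close>

definition left_shift_fun ::
  "('v, 'i) pre_digraph \<Rightarrow> real \<Rightarrow>
   ('i \<Rightarrow> real \<Rightarrow> 'k::{real_normed_field, euclidean_space}) \<Rightarrow> 'i \<Rightarrow> real \<Rightarrow> 'k" where
  "left_shift_fun G t f = (\<lambda>i s. \<Sum>\<^sub>\<infinity>j\<in>succ_arcs G (shift_n t s) i. f j (shift_pos t s))"

text \<open>The operator \<open>T\<^sub>t\<close> on classes: all representatives \<open>f\<close> of \<open>X\<close> contribute the same class.\<close>

definition left_shift ::
  "('v, 'i) pre_digraph \<Rightarrow> ('i \<Rightarrow> real \<Rightarrow> real) \<Rightarrow> real \<Rightarrow> real \<Rightarrow>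
   ('i \<Rightarrow> real \<Rightarrow> 'k::{real_normed_field, euclidean_space}) set \<Rightarrow> ('i \<Rightarrow> real \<Rightarrow> 'k) set" where
  "left_shift G \<rho> p t X = (\<Union>f\<in>X. Lp_rel G \<rho> p `` {left_shift_fun G t f})"


section \<open>Admissibility and the functions \<open>\<Phi>\<^sub>i\<close>\<close>

text \<open>
  Real powers on \<open>[0,\<infinity>]\<close>, with \<open>0\<^sup>r = \<infinity>\<close> and \<open>\<infinity>\<^sup>r = 0\<close> for \<open>r < 0\<close>.
\<close>

definition epowr :: "ennreal \<Rightarrow> real \<Rightarrow> ennreal" where
  "epowr x r =
     (if r = 0 then 1
      else if x = \<infinity> then (if r < 0 then 0 else \<infinity>)
      else if x = 0 then (if r < 0 then \<infinity> else 0)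
      else ennreal (enn2real x powr r))"

definition dual_weight_sum ::
  "('v, 'i) pre_digraph \<Rightarrow> ('i \<Rightarrow> real \<Rightarrow> real) \<Rightarrow> real \<Rightarrow> 'i \<Rightarrow> real \<Rightarrow> real \<Rightarrow> ennreal" where
  "dual_weight_sum G \<rho> p i t s =
     (\<Sum>\<^sub>\<infinity>j\<in>succ_arcs G (shift_n t s) i. ennreal (1 / \<rho> j (shift_pos t s) powr (1 / (p - 1))))"

definition admissible ::
  "('v, 'i) pre_digraph \<Rightarrow> ('i \<Rightarrow> real \<Rightarrow> real) \<Rightarrow> real \<Rightarrow> bool" where
  "admissible G \<rho> p \<longleftrightarrow>
     (\<exists>M::real. \<exists>\<omega>::real. 1 \<le> M \<and>
        (\<forall>i \<in> arcs G. \<forall>t \<ge> 0. \<forall>s \<in> {0..<1}.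
           epowr (dual_weight_sum G \<rho> p i t s) (p - 1)
             \<le> ennreal (M powr p * exp (p * \<omega> * t) * (1 / \<rho> i s))))"

definition Phi ::
  "('v, 'i) pre_digraph \<Rightarrow> ('i \<Rightarrow> real \<Rightarrow> real) \<Rightarrow> real \<Rightarrow> 'i \<Rightarrow> real \<Rightarrow> real \<Rightarrow> ennreal" where
  "Phi G \<rho> p i t s = epowr (dual_weight_sum G \<rho> p i t s) (1 - p)"

definition small_times ::
  "('v, 'i) pre_digraph \<Rightarrow> ('i \<Rightarrow> real \<Rightarrow> real) \<Rightarrow> real \<Rightarrow> 'i set \<Rightarrow> real \<Rightarrow> real \<Rightarrow> real set" where
  "small_times G \<rho> p K \<epsilon> \<alpha> =
     {t. 0 \<le> t \<and>
         (INF E \<in> {E \<in> sets lebesgue. E \<subseteq> {0..<1} \<and> \<alpha> < measure lebesgue E}.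
            \<integral>\<^sup>+s\<in>E. (\<Sum>i\<in>K. Phi G \<rho> p i t s) \<partial>lebesgue) < ennreal \<epsilon>}"


section \<open>Furstenberg families\<close>

definition furstenberg_family :: "real set set \<Rightarrow> bool" where
  "furstenberg_family \<F> \<longleftrightarrow>
     \<F> \<noteq> {} \<and> \<F> \<subseteq> Pow {0..} \<and> (\<forall>A B. A \<in> \<F> \<and> A \<subseteq> B \<and> B \<subseteq> {0..} \<longrightarrow> B \<in> \<F>)"

definition proper_family :: "real set set \<Rightarrow> bool" where
  "proper_family \<F> \<longleftrightarrow> \<F> \<noteq> {} \<and> {} \<notin> \<F>"

definition finite_invariant :: "real set set \<Rightarrow> bool" where
  "finite_invariant \<F> \<longleftrightarrow> (\<forall>A \<in> \<F>. \<forall>R > 0. A \<inter> {R<..} \<in> \<F>)"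

definition return_set :: "(real \<Rightarrow> 'x \<Rightarrow> 'x) \<Rightarrow> 'x set \<Rightarrow> 'x set \<Rightarrow> real set" where
  "return_set T U V = {t. 0 \<le> t \<and> T t ` U \<inter> V \<noteq> {}}"

definition F_transitive :: "real set set \<Rightarrow> 'x topology \<Rightarrow> (real \<Rightarrow> 'x \<Rightarrow> 'x) \<Rightarrow> bool" where
  "F_transitive \<F> X T \<longleftrightarrow>
     (\<forall>U V. openin X U \<and> U \<noteq> {} \<and> openin X V \<and> V \<noteq> {} \<longrightarrow> return_set T U V \<in> \<F>)"

definition F_recurrent :: "real set set \<Rightarrow> 'x topology \<Rightarrow> (real \<Rightarrow> 'x \<Rightarrow> 'x) \<Rightarrow> bool" where
  "F_recurrent \<F> X T \<longleftrightarrow> (\<forall>U. openin X U \<and> U \<noteq> {} \<longrightarrow> return_set T U U \<in> \<F>)"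

end

(*
  Since the tree has a root, a finite set K of edges has bounded depth, so for large t no edge of K
  is among the relevant descendants of any edge, and T_t annihilates every function supported on K.

  Transitivity from small times: truncated functions f, g with finite support are dense. For large t
  one perturbs f by a function h that T_t maps exactly to g restricted to E; distributing the values
  of g over the descendants proportionally to rho_j^(-1/(p-1)) gives |h|^p <= C^p times the integral
  of the Phi_i over E, where C bounds g. The loss outside E is small once m(E) is close to 1, by
  absolute continuity.

  Small times from recurrence: if u and T_t u are both close to the indicator of K, then |T_t u| >= 1/2
  on the edges of K outside a set of small measure, while Hoelder's inequality bounds
  Phi_i |T_t u|^p by the part of the norm of u sitting on descendants, which are disjoint from K.
*)
theory Submission
  imports Defs
begin

section \<open>Descendants in a rooted tree\<close>

text \<open>\<open>Phi G \<rho> p i t s\<close> is the least cost of the value 1 at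
  \<open>(i, s)\<close>. Put \<open>a j = \<rho> j powr (-1/(p-1))\<close>, taken at the coordinate
  \<open>shift_pos t s\<close>, and let D be the sum of the \<open>a j\<close> over the descendants.
  Since \<open>a j powr p * \<rho> j = a j\<close>, the values \<open>a j / D\<close> have sum 1 and
  weighted mass \<open>D powr (1 - p)\<close>; Hoelder's inequality says that no cheaper choice
  exists. The attained minimum yields the perturbation h, and its minimality yields the converse
  estimate. Three facts turn this pointwise problem into a statement about the norm. Every vertex
  has at most one parent, so distinct edges share no descendant of the same generation and the
  perturbations for the edges of K do not interfere. For fixed t the coordinate
  \<open>shift_pos t s\<close> is a rotation of the unit interval, so integrating over s computes
  the mass of a function from the values that the operator reads. Finally, finite invariance of the
  family allows the initial times, at which descendants may still meet the chosen finite set, to be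
  discarded.\<close>

lemma directed_treeD:
  assumes "directed_tree G"
  shows "nomulti_digraph G" "wf_digraph G" "countable (arcs G)"
    "\<And>u u' v. u \<rightarrow>\<^bsub>G\<^esub> v \<Longrightarrow> u' \<rightarrow>\<^bsub>G\<^esub> v \<Longrightarrow> u = u'"
proof -
  show *: "nomulti_digraph G" using assms by (simp add: directed_tree_def)
  show wf: "wf_digraph G" using * by (simp add: nomulti_digraph_def)
  show "\<And>u u' v. u \<rightarrow>\<^bsub>G\<^esub> v \<Longrightarrow> u' \<rightarrow>\<^bsub>G\<^esub> v \<Longrightarrow> u = u'"
    using assms by (auto simp: directed_tree_def)
  have "countable (verts G \<times> verts G)" using assms by (auto simp: directed_tree_def)
  moreover have "arc_to_ends G ` arcs G \<subseteq> verts G \<times> verts G"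
    using wf_digraph.tail_in_verts[OF wf] wf_digraph.head_in_verts[OF wf]
    by (auto simp: arc_to_ends_def)
  ultimately show "countable (arcs G)"
    using nomulti_digraph.inj_on_arc_to_ends[OF *] countable_image_inj_on countable_subset by metis
qed

lemma succ_arcs_subset: "i \<in> arcs G \<Longrightarrow> succ_arcs G n i \<subseteq> arcs G"
  by (cases n) auto

text \<open>Counting from tail to tail makes the number of steps exactly n, including the case n =
  0. Generations thereby become path lengths, which the root bounds.\<close>

lemma succ_arcs_relpow:
  assumes "i \<in> arcs G" "j \<in> succ_arcs G n i"
  shows "(tail G i, tail G j) \<in> arcs_ends G ^^ n"
  using assms(2)
proof (induction n arbitrary: j)
  case (Suc n)
  then obtain k where k: "k \<in> succ_arcs G n i" "head G k = tail G j" by auto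
  then have "k \<in> arcs G" using succ_arcs_subset[OF assms(1)] by blast
  then have "(tail G k, tail G j) \<in> arcs_ends G" using k by (auto simp: arcs_ends_conv intro!: rev_image_eqI[of k])
  with Suc.IH[OF k(1)] show ?case by auto
qed auto

text \<open>Having boundedly many ancestors is inherited along undirected edges, starting from the root.\<close>

lemma bounded_ancestry:
  assumes "directed_tree G" "rooted G" "v \<in> verts G"
  shows "\<exists>d. \<forall>n x. (x, v) \<in> arcs_ends G ^^ n \<longrightarrow> n \<le> d"
proof -
  define P where "P v \<longleftrightarrow> (\<exists>d. \<forall>n x. (x, v) \<in> arcs_ends G ^^ n \<longrightarrow> n \<le> d)" for v
  obtain r where r: "r \<in> verts G" "in_arcs G r = {}"
    using assms(2) by (auto simp: rooted_def is_root_def)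
  have "P r"
  proof -
    have "n = 0" if "(x, r) \<in> arcs_ends G ^^ n" for n x
      using that r(2) by (cases n) (auto simp: in_arcs_def arcs_ends_conv)
    then show ?thesis unfolding P_def by (intro exI[of _ 0]) auto
  qed
  \<comment> \<open>As u is the only parent of v, every nontrivial path into v passes through u
    last, so the bound grows by one.\<close>
  have down: "P v" if "P u" "u \<rightarrow>\<^bsub>G\<^esub> v" for u v
  proof -
    obtain d where d: "\<And>n x. (x, u) \<in> arcs_ends G ^^ n \<Longrightarrow> n \<le> d"
      using \<open>P u\<close> unfolding P_def by blast
    have "n \<le> Suc d" if "(x, v) \<in> arcs_ends G ^^ n" for n x
    proof (cases n)
      case (Suc m)
      then obtain y where y: "(x, y) \<in> arcs_ends G ^^ m" "y \<rightarrow>\<^bsub>G\<^esub> v"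
        using \<open>(x, v) \<in> _\<close> by auto
      then have "y = u" using directed_treeD(4)[OF assms(1)] \<open>u \<rightarrow>\<^bsub>G\<^esub> v\<close> by blast
      then show ?thesis using d y Suc by auto
    qed auto
    then show ?thesis unfolding P_def by blast
  qed
  \<comment> \<open>A path into v followed by the edge from v to u is a longer path into u, so the
    same bound works.\<close>
  have up: "P v" if "P u" "v \<rightarrow>\<^bsub>G\<^esub> u" for u v
  proof -
    obtain d where d: "\<And>n x. (x, u) \<in> arcs_ends G ^^ n \<Longrightarrow> n \<le> d"
      using \<open>P u\<close> unfolding P_def by blast
    have "n \<le> d" if "(x, v) \<in> arcs_ends G ^^ n" for n x
      using d[OF relpow_Suc_I[OF that \<open>v \<rightarrow>\<^bsub>G\<^esub> u\<close>]] by simp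
    then show ?thesis unfolding P_def by blast
  qed
  have "connected G" using assms(1) by (auto simp: directed_tree_def tree_def)
  then have "(r, v) \<in> rtrancl_on (verts G) (parcs (mk_symmetric G))"
    using r(1) assms(3) 
    by (auto simp: connected_def strongly_connected_def reachable_def mk_symmetric_def)
  then have "P v"
  proof (induction rule: rtrancl_on_induct)
    case (step y z)
    then have "y \<rightarrow>\<^bsub>G\<^esub> z \<or> z \<rightarrow>\<^bsub>G\<^esub> y"
      by (auto simp: mk_symmetric_def arcs_ends_conv)
    then show ?case using step up down by blast
  qed (use \<open>P r\<close> in auto)
  then show ?thesis unfolding P_def .
qed

text \<open>The n-th generation below any edge lies at depth at least n, while the finitely many
  edges of K have bounded depth. The bound N is uniform in i, so one time threshold serves all
  edges.\<close>

lemma succ_arcs_avoid_finite: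
  assumes "directed_tree G" "rooted G" "finite K" "K \<subseteq> arcs G"
  obtains N where "\<And>n i. n \<ge> N \<Longrightarrow> i \<in> arcs G \<Longrightarrow> succ_arcs G n i \<inter> K = {}"
proof -
  have "\<forall>j\<in>K. \<exists>d. \<forall>n x. (x, tail G j) \<in> arcs_ends G ^^ n \<longrightarrow> n \<le> d"
    using bounded_ancestry[OF assms(1,2)] wf_digraph.tail_in_verts[OF directed_treeD(2)[OF assms(1)]]
      assms(4) by blast
  then obtain d where d: "\<And>j n x. j \<in> K \<Longrightarrow> (x, tail G j) \<in> arcs_ends G ^^ n \<Longrightarrow> n \<le> d j"
    by metis
  show thesis
  proof
    \<comment> \<open>The sum of the depths is a convenient common upper bound; the successor makes
      it strict.\<close>
    fix n i assume n: "n \<ge> Suc (\<Sum>j\<in>K. d j)" and i: "i \<in> arcs G"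
    { fix j assume j: "j \<in> succ_arcs G n i" "j \<in> K"
      have "n \<le> d j" using d[OF j(2) succ_arcs_relpow[OF i j(1)]] .
      also have "\<dots> \<le> (\<Sum>j\<in>K. d j)" using assms(3) j by (simp add: member_le_sum)
      finally have False using n by simp }
    then show "succ_arcs G n i \<inter> K = {}" by blast
  qed
qed

text \<open>Descending paths can be retraced uniquely: the tail of j is the common head of k and k',
  unique parents identify their tails, and without parallel arcs k = k'. Hence pieces of a
  perturbation that belong to different edges never overlap.\<close>

lemma succ_arcs_disjoint:
  assumes "directed_tree G" "i \<in> arcs G" "i' \<in> arcs G"
    "j \<in> succ_arcs G n i" "j \<in> succ_arcs G n i'"
  shows "i = i'"
  using assms(4,5)
proof (induction n arbitrary: j)
  case (Suc n)
  then obtain k k' where k: "k \<in> succ_arcs G n i" "head G k = tail G j"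
      "k' \<in> succ_arcs G n i'" "head G k' = tail G j" by auto
  then have a: "k \<in> arcs G" "k' \<in> arcs G"
    using succ_arcs_subset[OF assms(2)] succ_arcs_subset[OF assms(3)] by blast+
  then have "tail G k \<rightarrow>\<^bsub>G\<^esub> tail G j" "tail G k' \<rightarrow>\<^bsub>G\<^esub> tail G j"
    using k by (auto simp: arcs_ends_conv intro: rev_image_eqI)
  then have "tail G k = tail G k'" by (rule directed_treeD(4)[OF assms(1)])
  then have "k = k'"
    using nomulti_digraph.no_multi_arcs[OF directed_treeD(1)[OF assms(1)] a] k
    by (simp add: arc_to_ends_def)
  then show ?case using Suc.IH k by blast
qed auto

text \<open>Needed so that sums of dual weights over descendants are positive and can be divided
  by.\<close>

lemma succ_arcs_nonempty:
  assumes "directed_tree G" "leafless G" "i \<in> arcs G"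
  shows "succ_arcs G n i \<noteq> {}"
proof (induction n)
  case (Suc n)
  then obtain k where k: "k \<in> succ_arcs G n i" by auto
  then have "k \<in> arcs G" using succ_arcs_subset[OF assms(3)] by blast
  then have "head G k \<in> verts G"
    using wf_digraph.head_in_verts[OF directed_treeD(2)[OF assms(1)]] by blast
  then have "out_arcs G (head G k) \<noteq> {}" using assms(2) by (auto simp: leafless_def is_leaf_def)
  then show ?case using k by (force simp: out_arcs_def)
qed auto

section \<open>Rotations of the unit interval\<close>

abbreviation unit_leb :: "real measure" where
  "unit_leb \<equiv> lebesgue_on {0..<1}"

lemma shift_n_frac: "0 \<le> t + s \<Longrightarrow> real (shift_n t s) = of_int \<lfloor>t + s\<rfloor>"
  by (simp add: shift_n_def)

lemma shift_pos_frac: "0 \<le> t + s \<Longrightarrow> shift_pos t s = frac (t + s)"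
  by (simp add: shift_pos_def frac_def shift_n_frac)

lemma shift_pos_in: "0 \<le> t \<Longrightarrow> s \<in> {0..<1} \<Longrightarrow> shift_pos t s \<in> {0..<1}"
  by (simp add: shift_pos_frac frac_lt_1)

text \<open>The two rotation parameters add up to an integer. The ceiling is used, rather than the
  parameter -t, because the formulas for \<open>shift_pos\<close> are available only for nonnegative
  arguments.\<close>

lemma shift_pos_inverse:
  assumes "0 \<le> t" "s \<in> {0..<1}"
  shows "shift_pos (of_int \<lceil>t\<rceil> - t) (shift_pos t s) = s"
proof -
  have 0: "0 \<le> of_int \<lceil>t\<rceil> - t" by simp
  have *: "frac (a + frac b) = frac (a + b)" for a b :: real
    by (metis add.commute frac_add_simps(1))
  have **: "frac (of_int k + s) = s" for k
    using assms(2) by (metis add.commute atLeastLessThan_iff frac_add_of_int_right frac_eq)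
  have "of_int \<lceil>t\<rceil> - t + (t + s) = of_int \<lceil>t\<rceil> + s" by simp
  then show ?thesis
    using assms 0 shift_pos_in[OF assms] * ** by (auto simp: shift_pos_frac)
qed

lemma emeasure_lebesgue_plus: "emeasure lebesgue ((+) a ` S) = emeasure lebesgue (S :: real set)"
  using emeasure_lebesgue_affine[of 1 a S] by (simp add: add.commute[of a])

text \<open>Modulo 1 the map is the rotation by the fractional part c of t. Cut at 1 - c, it
  consists of two translations, so the preimage of a set is a disjoint union of two translated
  pieces. Preimages of Lebesgue sets are required, hence the appeal to translation invariance of the
  Lebesgue sigma-algebra instead of Borel measurability of the map.\<close>

lemma
  assumes t: "0 \<le> t"
  shows measurable_shift_pos: "shift_pos t \<in> unit_leb \<rightarrow>\<^sub>M unit_leb"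
    and distr_shift_pos: "distr unit_leb unit_leb (shift_pos t) = unit_leb"
proof -
  define c where "c = frac t"
  have c: "0 \<le> c" "c < 1" by (auto simp: c_def frac_lt_1)
  have sp: "shift_pos t s = (if s < 1 - c then c + s else c + s - 1)" if "s \<in> {0..<1}" for s
    using that t frac_eq[of s] by (auto simp: shift_pos_frac frac_add c_def)
  have pre: "shift_pos t -` S \<inter> {0..<1} = (+) (- c) ` (S \<inter> {c..<1}) \<union> (+) (1 - c) ` (S \<inter> {0..<c})"
    if "S \<subseteq> {0..<1}" for S
  proof (intro set_eqI iffI)
    fix s assume s: "s \<in> shift_pos t -` S \<inter> {0..<1}"
    show "s \<in> (+) (- c) ` (S \<inter> {c..<1}) \<union> (+) (1 - c) ` (S \<inter> {0..<c})"
    proof (cases "s < 1 - c")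
      case True
      then show ?thesis using s sp[of s] by (intro UnI1 image_eqI[of _ _ "c + s"]) auto
    next
      case False
      then show ?thesis using s sp[of s] by (intro UnI2 image_eqI[of _ _ "c + s - 1"]) auto
    qed
  next
    fix s assume "s \<in> (+) (- c) ` (S \<inter> {c..<1}) \<union> (+) (1 - c) ` (S \<inter> {0..<c})"
    then show "s \<in> shift_pos t -` S \<inter> {0..<1}"
      using c sp[of s] by auto
  qed
  have meas: "(+) (- c) ` (S \<inter> {c..<1}) \<in> sets lebesgue" "(+) (1 - c) ` (S \<inter> {0..<c}) \<in> sets lebesgue"
    if "S \<in> sets lebesgue" for S
    by (intro lebesgue_sets_translation sets.Int that; simp)+
  show m: "shift_pos t \<in> unit_leb \<rightarrow>\<^sub>M unit_leb"
  proof (rule measurableI)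
    fix S assume S: "S \<in> sets unit_leb"
    then have "S \<subseteq> {0..<1}" "S \<in> sets lebesgue" by (auto simp: sets_restrict_space_iff)
    then have "shift_pos t -` S \<inter> {0..<1} \<in> sets lebesgue"
      using meas by (subst pre) auto
    then show "shift_pos t -` S \<inter> space unit_leb \<in> sets unit_leb"
      by (simp add: sets_restrict_space_iff)
  qed (use shift_pos_in[OF t] in auto)
  show "distr unit_leb unit_leb (shift_pos t) = unit_leb"
  proof (rule measure_eqI)
    fix S assume "S \<in> sets (distr unit_leb unit_leb (shift_pos t))"
    then have S: "S \<subseteq> {0..<1}" "S \<in> sets lebesgue" "S \<in> sets unit_leb"
      by (auto simp: sets_restrict_space_iff)
    have "emeasure (distr unit_leb unit_leb (shift_pos t)) S
        = emeasure lebesgue ((+) (- c) ` (S \<inter> {c..<1}) \<union> (+) (1 - c) ` (S \<inter> {0..<c}))"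
      using S pre[OF S(1)] meas[OF S(2)]
      by (simp only: emeasure_distr[OF m S(3)] space_restrict_space space_completion space_lborel)
        (subst emeasure_restrict_space, use c in auto)
    also have "\<dots> = emeasure lebesgue ((+) (- c) ` (S \<inter> {c..<1}))
        + emeasure lebesgue ((+) (1 - c) ` (S \<inter> {0..<c}))"
      by (rule plus_emeasure[symmetric]) (use meas S c in auto)
    also have "\<dots> = emeasure lebesgue (S \<inter> {c..<1}) + emeasure lebesgue (S \<inter> {0..<c})"
      by (simp only: emeasure_lebesgue_plus)
    also have "\<dots> = emeasure lebesgue ((S \<inter> {c..<1}) \<union> (S \<inter> {0..<c}))"
      by (rule plus_emeasure) (use S in auto)
    also have "(S \<inter> {c..<1}) \<union> (S \<inter> {0..<c}) = S" using S(1) c by auto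
    finally show "emeasure (distr unit_leb unit_leb (shift_pos t)) S = emeasure unit_leb S"
      using S by (simp add: emeasure_restrict_space)
  qed simp
qed

lemma nn_integral_shift_pos:
  assumes "0 \<le> t" "f \<in> borel_measurable unit_leb"
  shows "(\<integral>\<^sup>+s. f (shift_pos t s) \<partial>unit_leb) = (\<integral>\<^sup>+s. f s \<partial>unit_leb)"
  using nn_integral_distr[OF measurable_shift_pos[OF assms(1)], of f] assms(2)
  by (simp add: distr_shift_pos[OF assms(1)])

lemma AE_shift_pos:
  assumes "0 \<le> t" "AE s in unit_leb. P s"
  shows "AE s in unit_leb. P (shift_pos t s)"
proof -
  obtain N where N: "N \<in> null_sets unit_leb" "{s \<in> space unit_leb. \<not> P s} \<subseteq> N"
    using assms(2) by (auto simp: eventually_ae_filter)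
  have "N \<in> null_sets (distr unit_leb unit_leb (shift_pos t))"
    using N(1) by (simp add: distr_shift_pos[OF assms(1)])
  then have "shift_pos t -` N \<inter> space unit_leb \<in> null_sets unit_leb"
    by (simp add: null_sets_distr_iff[OF measurable_shift_pos[OF assms(1)]])
  moreover have "{s \<in> space unit_leb. \<not> P (shift_pos t s)} \<subseteq> shift_pos t -` N \<inter> space unit_leb"
    using N(2) shift_pos_in[OF assms(1)] by auto
  ultimately show ?thesis by (rule AE_I')
qed

lemma measurable_shift_n: "shift_n t \<in> measurable unit_leb (count_space UNIV)"
proof -
  have "shift_n t \<in> measurable borel (count_space UNIV)"
    unfolding shift_n_def by measurable
  then have "shift_n t \<in> measurable lborel (count_space UNIV)" by simp
  then show ?thesis by (intro measurable_restrict_space1 measurable_completion)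
qed

section \<open>Sums of extended nonnegative reals as integrals\<close>

text \<open>Once sums over arcs are integrals, Tonelli's theorem and dominated convergence apply to
  them. An enumeration of an infinite A turns both sides into the same series.\<close>

lemma infsum_eq_nn_integral_count_space:
  fixes f :: "'a \<Rightarrow> ennreal"
  assumes "countable A"
  shows "infsum f A = (\<integral>\<^sup>+x. f x \<partial>count_space A)"
proof (cases "finite A")
  case True
  then show ?thesis by (simp add: nn_integral_count_space_finite)
next
  case False
  then have b: "bij_betw (from_nat_into A) UNIV A" by (rule bij_betw_from_nat_into[OF assms])
  have "infsum f A = infsum (\<lambda>n. f (from_nat_into A n)) UNIV"
    by (rule infsum_reindex_bij_betw[OF b, symmetric])
  also have "\<dots> = (\<Sum>n. f (from_nat_into A n))"
  proof -
    have "(\<lambda>n. f (from_nat_into A n)) sums infsum (\<lambda>n. f (from_nat_into A n)) UNIV"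
      by (intro has_sum_imp_sums has_sum_infsum nonneg_summable_on_complete) simp
    then show ?thesis by (simp add: sums_iff)
  qed
  also have "\<dots> = (\<integral>\<^sup>+x. f x \<partial>count_space A)"
    by (simp add: nn_integral_bij_count_space[OF b, symmetric] nn_integral_count_space_nat)
  finally show ?thesis .
qed

text \<open>Jensen's inequality for the p-th power at the points \<open>x j / a j\<close> with
  weights \<open>a j / S\<close>. This is the finite form of Hoelder's inequality, and with two
  terms it also yields Minkowski's inequality below.\<close>

lemma power_mean_sum:
  fixes x a :: "'j \<Rightarrow> real"
  assumes "finite F" "1 < p" "\<And>j. j \<in> F \<Longrightarrow> 0 < a j" "\<And>j. j \<in> F \<Longrightarrow> 0 \<le> x j"
  shows "(\<Sum>j\<in>F. x j) powr p \<le> (\<Sum>j\<in>F. a j) powr (p - 1) * (\<Sum>j\<in>F. x j powr p * a j powr (1 - p))"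
proof -
  \<comment> \<open>Discarding zero terms keeps Jensen's inequality at positive points. The sum of
    the \<open>x j\<close> is unchanged and the right side can only grow when they return.\<close>
  define F' where "F' = {j \<in> F. 0 < x j}"
  define S where "S = (\<Sum>j\<in>F'. a j)"
  have F': "finite F'" "F' \<subseteq> F" using assms(1) by (auto simp: F'_def)
  have "(\<Sum>j\<in>F'. x j) powr p \<le> S powr (p - 1) * (\<Sum>j\<in>F'. x j powr p * a j powr (1 - p))"
  proof (cases "F' = {}")
    case False
    have S: "0 < S" unfolding S_def using F' False assms(3) by (intro sum_pos) auto
    have pos: "0 < a j" "0 < x j" if "j \<in> F'" for j
      using that assms(3) by (auto simp: F'_def)
    have "(\<Sum>j\<in>F'. a j / S) = S / S" unfolding S_def by (rule sum_divide_distrib[symmetric])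
    then have "(\<Sum>j\<in>F'. a j / S) = 1" using S by simp
    then have "(\<Sum>j\<in>F'. (a j / S) *\<^sub>R (x j / a j)) powr p \<le> (\<Sum>j\<in>F'. (a j / S) * (x j / a j) powr p)"
      using assms(2) S pos by (intro convex_on_sum[OF F'(1) False powr_convex[of p]]) (auto simp: less_imp_le)
    moreover have "(\<Sum>j\<in>F'. (a j / S) *\<^sub>R (x j / a j)) = (\<Sum>j\<in>F'. x j) / S"
      unfolding sum_divide_distrib
    proof (rule sum.cong)
      fix j assume "j \<in> F'"
      with pos(1)[OF this] show "(a j / S) *\<^sub>R (x j / a j) = x j / S" using S by simp
    qed simp
    moreover have "(\<Sum>j\<in>F'. (a j / S) * (x j / a j) powr p) = (\<Sum>j\<in>F'. x j powr p * a j powr (1 - p)) / S"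
      unfolding sum_divide_distrib
    proof (rule sum.cong)
      fix j assume "j \<in> F'"
      from pos[OF this] show "(a j / S) * (x j / a j) powr p = x j powr p * a j powr (1 - p) / S"
        using S by (simp add: powr_divide powr_diff field_simps)
    qed simp
    moreover have "((\<Sum>j\<in>F'. x j) / S) powr p = (\<Sum>j\<in>F'. x j) powr p / S powr p"
      by (rule powr_divide)
    ultimately have "(\<Sum>j\<in>F'. x j) powr p / S powr p \<le> (\<Sum>j\<in>F'. x j powr p * a j powr (1 - p)) / S"
      by simp
    then have "(\<Sum>j\<in>F'. x j) powr p \<le> (\<Sum>j\<in>F'. x j powr p * a j powr (1 - p)) / S * S powr p"
      using S by (subst (asm) pos_divide_le_eq) auto
    then show ?thesis using S by (simp add: powr_diff mult_ac)
  qed (use assms in auto)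
  also have "\<dots> \<le> (\<Sum>j\<in>F. a j) powr (p - 1) * (\<Sum>j\<in>F. x j powr p * a j powr (1 - p))"
    unfolding S_def
    by (intro mult_mono powr_mono2 sum_mono2 sum_nonneg) (use assms F' in \<open>auto intro: less_imp_le\<close>)
  also have "(\<Sum>j\<in>F'. x j) = (\<Sum>j\<in>F. x j)"
    by (rule sum.mono_neutral_left) (use assms F' in \<open>auto simp: F'_def less_eq_real_def\<close>)
  finally show ?thesis .
qed

lemma sum_le_nn_integral_count_space:
  fixes f :: "'a \<Rightarrow> ennreal"
  assumes "finite F" "F \<subseteq> A"
  shows "sum f F \<le> (\<integral>\<^sup>+x. f x \<partial>count_space A)"
proof -
  have "sum f F = (\<integral>\<^sup>+x. f x \<partial>count_space F)" using assms by (simp add: nn_integral_count_space_finite)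
  also have "\<dots> \<le> (\<integral>\<^sup>+x. f x \<partial>count_space A)"
    using assms
    by (auto simp: nn_integral_count_space_indicator intro!: nn_integral_mono split: split_indicator)
  finally show ?thesis .
qed

lemma norm_infsum_le_of_finite_sums:
  fixes u :: "'j \<Rightarrow> 'b::banach"
  assumes "0 \<le> B" "\<And>F. finite F \<Longrightarrow> F \<subseteq> A \<Longrightarrow> (\<Sum>j\<in>F. norm (u j)) \<le> B"
  shows "norm (infsum u A) \<le> B"
proof -
  have s: "(\<lambda>j. norm (u j)) summable_on A"
    by (rule nonneg_bdd_above_summable_on) (use assms(2) in \<open>auto intro!: bdd_aboveI[of _ B]\<close>)
  have "norm (infsum u A) \<le> (\<Sum>\<^sub>\<infinity>j\<in>A. norm (u j))" using s by (rule norm_infsum_bound)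
  also have "\<dots> \<le> B" using s assms(2) by (rule infsum_le_finite_sums)
  finally show ?thesis .
qed

text \<open>Hoelder's inequality for the exponents \<open>p\<close> and \<open>p/(p-1)\<close>, written without the dual exponent.\<close>

lemma epowr_infsum_le:
  fixes u :: "'j \<Rightarrow> 'b::banach" and \<rho> :: "'j \<Rightarrow> real"
  assumes "countable A" "1 < p" "\<And>j. j \<in> A \<Longrightarrow> 0 < \<rho> j"
  defines "S \<equiv> (\<Sum>\<^sub>\<infinity>j\<in>A. ennreal (1 / \<rho> j powr (1 / (p - 1))))"
  shows "epowr S (1 - p) * ennreal (norm (infsum u A) powr p)
       \<le> (\<integral>\<^sup>+j. ennreal (norm (u j) powr p * \<rho> j) \<partial>count_space A)" (is "_ \<le> ?R")
proof -
  define a where "a j = 1 / \<rho> j powr (1 / (p - 1))" for j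
  have a: "0 < a j" if "j \<in> A" for j using assms(3)[OF that] by (simp add: a_def)
  \<comment> \<open>The exponent in \<open>a\<close> is chosen so that the factor
    \<open>a j powr (1 - p)\<close> in the finite inequality is exactly the weight.\<close>
  have ar: "a j powr (1 - p) = \<rho> j" if "j \<in> A" for j
  proof -
    have "a j = \<rho> j powr (- 1 / (p - 1))"
      using assms(3)[OF that] by (simp add: a_def powr_minus_divide)
    then have "a j powr (1 - p) = \<rho> j powr (- 1 / (p - 1) * (1 - p))"
      by (simp add: powr_powr)
    also have "- 1 / (p - 1) * (1 - p) = 1" using assms(2) by (simp add: field_simps)
    finally show ?thesis using assms(3)[OF that] by simp
  qed
  have S: "S = (\<integral>\<^sup>+j. ennreal (a j) \<partial>count_space A)"
    unfolding S_def a_def by (rule infsum_eq_nn_integral_count_space[OF assms(1)])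
  show ?thesis
  \<comment> \<open>The degenerate cases hold by the conventions on [0,\<infinity>]: for empty A the
    left side is \<infinity> * 0 = 0, for infinite S the factor \<open>epowr S (1 - p)\<close> is
    0.\<close>
  proof (cases "A = {} \<or> S = \<infinity> \<or> ?R = \<infinity>")
    case True
    then show ?thesis using assms(2) by (auto simp: epowr_def)
  next
    case False
    obtain s where s: "S = ennreal s" "0 \<le> s" using False by (cases S) auto
    obtain r where r: "?R = ennreal r" "0 \<le> r" using False by (cases ?R) auto
    note sr = s r
    obtain j0 where "j0 \<in> A" using False by blast
    then have "ennreal (a j0) \<le> S"
      using sum_le_nn_integral_count_space[of "{j0}" A "\<lambda>j. ennreal (a j)"] by (simp add: S)
    then have "a j0 \<le> s" using sr by simp
    then have s0: "0 < s" using a[OF \<open>j0 \<in> A\<close>] by simp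
    \<comment> \<open>A bound uniform in F: it forces absolute convergence, so the default value of
      \<open>infsum\<close> does not occur here.\<close>
    have fin: "(\<Sum>j\<in>F. norm (u j)) \<le> (s powr (p - 1) * r) powr (1 / p)"
      if F: "finite F" "F \<subseteq> A" for F
    proof -
      have "ennreal (\<Sum>j\<in>F. a j) \<le> ennreal s"
        using sum_le_nn_integral_count_space[OF F, of "\<lambda>j. ennreal (a j)"] a F sr
        by (simp add: S subset_iff less_imp_le)
      then have 1: "(\<Sum>j\<in>F. a j) \<le> s" using sr by simp
      have "ennreal (\<Sum>j\<in>F. norm (u j) powr p * \<rho> j) \<le> ennreal r"
        using sum_le_nn_integral_count_space[OF F, of "\<lambda>j. ennreal (norm (u j) powr p * \<rho> j)"] assms(3) F sr
        by (simp add: subset_iff less_imp_le)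
      then have 2: "(\<Sum>j\<in>F. norm (u j) powr p * \<rho> j) \<le> r" using sr by simp
      have "(\<Sum>j\<in>F. norm (u j)) powr p
          \<le> (\<Sum>j\<in>F. a j) powr (p - 1) * (\<Sum>j\<in>F. norm (u j) powr p * a j powr (1 - p))"
        by (rule power_mean_sum) (use F assms(2) a in auto)
      also have "(\<Sum>j\<in>F. norm (u j) powr p * a j powr (1 - p)) = (\<Sum>j\<in>F. norm (u j) powr p * \<rho> j)"
        by (rule sum.cong) (use F ar in auto)
      also have "(\<Sum>j\<in>F. a j) powr (p - 1) * (\<Sum>j\<in>F. norm (u j) powr p * \<rho> j) \<le> s powr (p - 1) * r"
        by (intro mult_mono powr_mono2 1 2 sum_nonneg) (use F a assms(2,3) in \<open>auto simp: subset_iff less_imp_le\<close>)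
      finally have "((\<Sum>j\<in>F. norm (u j)) powr p) powr (1 / p) \<le> (s powr (p - 1) * r) powr (1 / p)"
        using assms(2) by (intro powr_mono2) auto
      then show ?thesis using assms(2) by (simp add: powr_powr sum_nonneg)
    qed
    have "norm (infsum u A) powr p \<le> ((s powr (p - 1) * r) powr (1 / p)) powr p"
      using assms(2) by (intro powr_mono2 norm_infsum_le_of_finite_sums fin) auto
    also have "\<dots> = s powr (p - 1) * r" using assms(2) sr by (simp add: powr_powr)
    finally have "s powr (1 - p) * norm (infsum u A) powr p \<le> s powr (1 - p) * (s powr (p - 1) * r)"
      by (rule mult_left_mono) simp
    also have "\<dots> = r" using s0 by (simp flip: powr_add mult.assoc)
    finally show ?thesis using s0 sr assms(2) by (simp add: epowr_def flip: ennreal_mult')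
  qed
qed

section \<open>The weighted space\<close>

locale weighted_tree =
  fixes G :: "('v, 'i) pre_digraph" and \<rho> :: "'i \<Rightarrow> real \<Rightarrow> real" and p :: real
  assumes tree: "directed_tree G" and weight: "is_weight G \<rho>" and p: "1 < p"
begin

lemma countable_arcs [simp]: "countable (arcs G)"
  by (rule directed_treeD(3)[OF tree])

lemma weight_pos: "i \<in> arcs G \<Longrightarrow> s \<in> {0..<1} \<Longrightarrow> 0 < \<rho> i s"
  using weight by (auto simp: is_weight_def)

lemma weight_integrable: "i \<in> arcs G \<Longrightarrow> integrable unit_leb (\<rho> i)"
  using weight by (auto simp: is_weight_def)

lemma weight_measurable: "i \<in> arcs G \<Longrightarrow> \<rho> i \<in> borel_measurable unit_leb"
  using weight_integrable by blast

definition Lp_meas :: "('i \<Rightarrow> real \<Rightarrow> 'k::{real_normed_field, euclidean_space}) \<Rightarrow> bool" where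
  "Lp_meas f \<longleftrightarrow> (\<forall>i\<in>arcs G. f i \<in> borel_measurable unit_leb)"

lemma Lp_fun_iff: "f \<in> Lp_fun G \<rho> p \<longleftrightarrow> Lp_meas f \<and> Lp_mass G \<rho> p f < \<infinity>"
  by (simp add: Lp_fun_def Lp_meas_def)

lemma Lp_measD: "Lp_meas f \<Longrightarrow> i \<in> arcs G \<Longrightarrow> f i \<in> borel_measurable unit_leb"
  by (simp add: Lp_meas_def)

lemma Lp_meas_integrand [measurable]:
  assumes "Lp_meas f" "i \<in> arcs G"
  shows "(\<lambda>s. ennreal (norm (f i s) powr p * \<rho> i s)) \<in> borel_measurable unit_leb"
  using Lp_measD[OF assms] weight_measurable[OF assms(2)] by measurable

lemma Lp_meas_add: "Lp_meas f \<Longrightarrow> Lp_meas g \<Longrightarrow> Lp_meas (\<lambda>i s. f i s + g i s)"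
  and Lp_meas_diff: "Lp_meas f \<Longrightarrow> Lp_meas g \<Longrightarrow> Lp_meas (\<lambda>i s. f i s - g i s)"
  by (auto simp: Lp_meas_def intro!: borel_measurable_add borel_measurable_diff)

lemma Lp_mass_nn_integral:
  "Lp_mass G \<rho> p f = (\<integral>\<^sup>+i. \<integral>\<^sup>+s. ennreal (norm (f i s) powr p * \<rho> i s) \<partial>unit_leb \<partial>count_space (arcs G))"
  by (simp add: Lp_mass_def infsum_eq_nn_integral_count_space)

lemma Lp_mass_cong_AE:
  assumes "\<And>i. i \<in> arcs G \<Longrightarrow> AE s in unit_leb. norm (f i s) = norm (g i s)"
  shows "Lp_mass G \<rho> p f = Lp_mass G \<rho> p g"
  unfolding Lp_mass_nn_integral
  by (intro nn_integral_cong nn_integral_cong_AE) (use assms in force)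

lemma Lp_mass_mono:
  assumes "\<And>i s. i \<in> arcs G \<Longrightarrow> s \<in> {0..<1} \<Longrightarrow> norm (f i s) \<le> norm (g i s)"
  shows "Lp_mass G \<rho> p f \<le> Lp_mass G \<rho> p g"
  unfolding Lp_mass_nn_integral
  using p assms weight_pos
  by (intro nn_integral_mono ennreal_leI mult_right_mono powr_mono2) (auto simp: less_imp_le)

text \<open>Minkowski's inequality at the level of masses. The two-term power mean inequality with
  weights a and b bounds the p-th power of a sum pointwise by A and B times the separate p-th
  powers; A and B are such that integration gives exactly \<open>(a + b) powr p\<close>. Positive
  radii are needed for these weights.\<close>

lemma Lp_mass_add_le:
  fixes f g :: "'i \<Rightarrow> real \<Rightarrow> 'k::{real_normed_field, euclidean_space}"
  assumes f: "Lp_meas f" "Lp_mass G \<rho> p f \<le> ennreal (a powr p)"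
    and g: "Lp_meas g" "Lp_mass G \<rho> p g \<le> ennreal (b powr p)"
    and ab: "0 < a" "0 < b"
  shows "Lp_mass G \<rho> p (\<lambda>i s. f i s + g i s) \<le> ennreal ((a + b) powr p)"
proof -
  define A where "A = (a + b) powr (p - 1) * a powr (1 - p)"
  define B where "B = (a + b) powr (p - 1) * b powr (1 - p)"
  have AB: "0 \<le> A" "0 \<le> B" by (auto simp: A_def B_def)
  have pt: "norm (x + y) powr p \<le> A * norm x powr p + B * norm y powr p" for x y :: 'k
  proof -
    have "norm (x + y) powr p \<le> (norm x + norm y) powr p"
      using p by (intro powr_mono2 norm_triangle_ineq) auto
    also have "\<dots> \<le> A * norm x powr p + B * norm y powr p"
      using power_mean_sum[of "UNIV :: bool set" p "\<lambda>c. if c then a else b" "\<lambda>c. if c then norm x else norm y"] p ab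
      by (simp add: UNIV_bool A_def B_def algebra_simps)
    finally show ?thesis .
  qed
  have "Lp_mass G \<rho> p (\<lambda>i s. f i s + g i s)
     \<le> (\<integral>\<^sup>+i. \<integral>\<^sup>+s. (ennreal A * ennreal (norm (f i s) powr p * \<rho> i s)
           + ennreal B * ennreal (norm (g i s) powr p * \<rho> i s)) \<partial>unit_leb \<partial>count_space (arcs G))"
    unfolding Lp_mass_nn_integral
  proof (intro nn_integral_mono)
    fix i s assume "i \<in> space (count_space (arcs G))" "s \<in> space unit_leb"
    then have r: "0 < \<rho> i s" using weight_pos by simp
    have "norm (f i s + g i s) powr p * \<rho> i s
        \<le> (A * norm (f i s) powr p + B * norm (g i s) powr p) * \<rho> i s"
      using r pt by (intro mult_right_mono) auto
    also have "\<dots> = A * (norm (f i s) powr p * \<rho> i s) + B * (norm (g i s) powr p * \<rho> i s)"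
      by (simp add: algebra_simps)
    finally show "ennreal (norm (f i s + g i s) powr p * \<rho> i s)
      \<le> ennreal A * ennreal (norm (f i s) powr p * \<rho> i s) + ennreal B * ennreal (norm (g i s) powr p * \<rho> i s)"
      using AB r by (simp add: ennreal_mult'[symmetric] ennreal_plus[symmetric] del: ennreal_plus)
  qed
  also have "\<dots> = (\<integral>\<^sup>+i. (ennreal A * (\<integral>\<^sup>+s. ennreal (norm (f i s) powr p * \<rho> i s) \<partial>unit_leb)
       + ennreal B * (\<integral>\<^sup>+s. ennreal (norm (g i s) powr p * \<rho> i s) \<partial>unit_leb)) \<partial>count_space (arcs G))"
  proof (intro nn_integral_cong)
    fix i assume "i \<in> space (count_space (arcs G))"
    then have "i \<in> arcs G" by simp
    note [measurable] = Lp_meas_integrand[OF f(1) this] Lp_meas_integrand[OF g(1) this]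
    show "(\<integral>\<^sup>+s. (ennreal A * ennreal (norm (f i s) powr p * \<rho> i s)
           + ennreal B * ennreal (norm (g i s) powr p * \<rho> i s)) \<partial>unit_leb)
       = ennreal A * (\<integral>\<^sup>+s. ennreal (norm (f i s) powr p * \<rho> i s) \<partial>unit_leb)
       + ennreal B * (\<integral>\<^sup>+s. ennreal (norm (g i s) powr p * \<rho> i s) \<partial>unit_leb)"
      by (simp add: nn_integral_add nn_integral_cmult)
  qed
  also have "\<dots> = ennreal A * Lp_mass G \<rho> p f + ennreal B * Lp_mass G \<rho> p g"
    by (simp add: nn_integral_add nn_integral_cmult Lp_mass_nn_integral)
  also have "\<dots> \<le> ennreal A * ennreal (a powr p) + ennreal B * ennreal (b powr p)"
    by (intro add_mono mult_left_mono f g) auto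
  also have "\<dots> = ennreal (A * a powr p + B * b powr p)"
    using AB by (simp add: ennreal_mult')
  also have "A * a powr p + B * b powr p = (a + b) powr p"
  proof -
    have "A * a powr p = (a + b) powr (p - 1) * a" "B * b powr p = (a + b) powr (p - 1) * b"
      using ab by (simp_all add: A_def B_def mult.assoc flip: powr_add)
    then have "A * a powr p + B * b powr p = (a + b) powr (p - 1) * (a + b)"
      by (simp add: algebra_simps)
    also have "\<dots> = (a + b) powr p" using ab by (simp add: powr_diff)
    finally show ?thesis .
  qed
  finally show ?thesis .
qed

lemma Lp_mass_uminus [simp]: "Lp_mass G \<rho> p (\<lambda>i s. - f i s) = Lp_mass G \<rho> p f"
  by (rule Lp_mass_cong_AE) simp

lemma Lp_mass_minus_commute: "Lp_mass G \<rho> p (\<lambda>i s. f i s - g i s) = Lp_mass G \<rho> p (\<lambda>i s. g i s - f i s)"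
  by (rule Lp_mass_cong_AE) (simp add: norm_minus_commute)

section \<open>The norm obtained from the mass\<close>

lemma Lp_norm_nonneg: "0 \<le> Lp_norm G \<rho> p f"
  by (simp add: Lp_norm_def)

text \<open>Finiteness matters: \<open>enn2real\<close> sends \<infinity> to 0, so an infinite mass
  would have \<open>Lp_norm\<close> equal to 0.\<close>

lemma Lp_mass_norm: "Lp_mass G \<rho> p f < \<infinity> \<Longrightarrow> Lp_mass G \<rho> p f = ennreal (Lp_norm G \<rho> p f powr p)"
  using p by (cases "Lp_mass G \<rho> p f") (auto simp: Lp_norm_def powr_powr)

lemma Lp_norm_le_iff:
  assumes "Lp_mass G \<rho> p f < \<infinity>" "0 \<le> a"
  shows "Lp_norm G \<rho> p f \<le> a \<longleftrightarrow> Lp_mass G \<rho> p f \<le> ennreal (a powr p)"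
proof
  assume "Lp_norm G \<rho> p f \<le> a"
  then show "Lp_mass G \<rho> p f \<le> ennreal (a powr p)"
    unfolding Lp_mass_norm[OF assms(1)] using p by (intro ennreal_leI powr_mono2 Lp_norm_nonneg) auto
next
  assume "Lp_mass G \<rho> p f \<le> ennreal (a powr p)"
  then have "Lp_norm G \<rho> p f powr p \<le> a powr p"
    unfolding Lp_mass_norm[OF assms(1)] by simp
  then show "Lp_norm G \<rho> p f \<le> a"
    using p powr_less_mono2[of p a "Lp_norm G \<rho> p f"] assms(2) Lp_norm_nonneg[of f] by force
qed

lemma Lp_norm_less_iff:
  assumes "Lp_mass G \<rho> p f < \<infinity>" "0 \<le> a"
  shows "Lp_norm G \<rho> p f < a \<longleftrightarrow> Lp_mass G \<rho> p f < ennreal (a powr p)"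
proof
  assume "Lp_norm G \<rho> p f < a"
  then show "Lp_mass G \<rho> p f < ennreal (a powr p)"
    unfolding Lp_mass_norm[OF assms(1)] using p Lp_norm_nonneg[of f]
    by (intro ennreal_lessI powr_less_mono2) (auto intro: le_less_trans)
next
  assume "Lp_mass G \<rho> p f < ennreal (a powr p)"
  then have "Lp_norm G \<rho> p f powr p < a powr p"
    unfolding Lp_mass_norm[OF assms(1)] by (simp add: ennreal_less_iff)
  then show "Lp_norm G \<rho> p f < a"
    using p powr_mono2[of p a "Lp_norm G \<rho> p f"] assms(2) by force
qed

lemma Lp_fun_add:
  assumes "f \<in> Lp_fun G \<rho> p" "g \<in> Lp_fun G \<rho> p"
  shows "(\<lambda>i s. f i s + g i s) \<in> Lp_fun G \<rho> p"
    and "Lp_norm G \<rho> p (\<lambda>i s. f i s + g i s) \<le> Lp_norm G \<rho> p f + Lp_norm G \<rho> p g"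
proof -
  have f: "Lp_meas f" "Lp_mass G \<rho> p f < \<infinity>" and g: "Lp_meas g" "Lp_mass G \<rho> p g < \<infinity>"
    using assms by (auto simp: Lp_fun_iff)
  \<comment> \<open>The norms may vanish, so both radii are enlarged by e to become positive; e
    tends to 0 at the end.\<close>
  have *: "Lp_mass G \<rho> p (\<lambda>i s. f i s + g i s) \<le> ennreal (((Lp_norm G \<rho> p f + e) + (Lp_norm G \<rho> p g + e)) powr p)"
    if "0 < e" for e
    using that Lp_norm_nonneg[of f] Lp_norm_nonneg[of g]
      Lp_norm_le_iff[OF f(2), of "Lp_norm G \<rho> p f + e"] Lp_norm_le_iff[OF g(2), of "Lp_norm G \<rho> p g + e"]
    by (intro Lp_mass_add_le f g) auto
  have fin: "Lp_mass G \<rho> p (\<lambda>i s. f i s + g i s) < \<infinity>"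
    using *[of 1] by (simp add: le_less_trans[OF _ ennreal_less_top])
  then show "(\<lambda>i s. f i s + g i s) \<in> Lp_fun G \<rho> p"
    using Lp_meas_add f g by (auto simp: Lp_fun_iff)
  show "Lp_norm G \<rho> p (\<lambda>i s. f i s + g i s) \<le> Lp_norm G \<rho> p f + Lp_norm G \<rho> p g"
  proof (rule field_le_epsilon)
    fix e :: real assume "0 < e"
    then have "Lp_norm G \<rho> p (\<lambda>i s. f i s + g i s) \<le> (Lp_norm G \<rho> p f + e / 2) + (Lp_norm G \<rho> p g + e / 2)"
      using *[of "e / 2"] Lp_norm_nonneg[of f] Lp_norm_nonneg[of g]
      by (subst Lp_norm_le_iff[OF fin]) auto
    then show "Lp_norm G \<rho> p (\<lambda>i s. f i s + g i s) \<le> Lp_norm G \<rho> p f + Lp_norm G \<rho> p g + e" by simp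
  qed
qed

lemma Lp_fun_diff:
  assumes "f \<in> Lp_fun G \<rho> p" "g \<in> Lp_fun G \<rho> p"
  shows "(\<lambda>i s. f i s - g i s) \<in> Lp_fun G \<rho> p"
proof -
  have "(\<lambda>i s. - g i s) \<in> Lp_fun G \<rho> p"
    using assms(2) by (auto simp: Lp_fun_iff Lp_meas_def)
  from Lp_fun_add(1)[OF assms(1) this] show ?thesis by simp
qed

lemma Lp_norm_eq_0_iff:
  assumes "f \<in> Lp_fun G \<rho> p"
  shows "Lp_norm G \<rho> p f = 0 \<longleftrightarrow> (\<forall>i\<in>arcs G. AE s in unit_leb. f i s = 0)"
proof -
  have f: "Lp_meas f" "Lp_mass G \<rho> p f < \<infinity>" using assms by (auto simp: Lp_fun_iff)
  have "Lp_norm G \<rho> p f = 0 \<longleftrightarrow> Lp_mass G \<rho> p f = 0"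
    using p f(2) by (cases "Lp_mass G \<rho> p f") (auto simp: Lp_norm_def)
  also have "\<dots> \<longleftrightarrow> (\<forall>i\<in>arcs G. (\<integral>\<^sup>+s. ennreal (norm (f i s) powr p * \<rho> i s) \<partial>unit_leb) = 0)"
    by (simp add: Lp_mass_nn_integral nn_integral_0_iff_AE AE_count_space)
  also have "\<dots> \<longleftrightarrow> (\<forall>i\<in>arcs G. AE s in unit_leb. f i s = 0)"
  proof (rule ball_cong)
    fix i assume i: "i \<in> arcs G"
    have "(\<integral>\<^sup>+s. ennreal (norm (f i s) powr p * \<rho> i s) \<partial>unit_leb) = 0
       \<longleftrightarrow> (AE s in unit_leb. ennreal (norm (f i s) powr p * \<rho> i s) = 0)"
      by (rule nn_integral_0_iff_AE[OF Lp_meas_integrand[OF f(1) i]])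
    also have "\<dots> \<longleftrightarrow> (AE s in unit_leb. f i s = 0)"
    proof (rule AE_cong)
      fix s assume "s \<in> space unit_leb"
      then have "0 < \<rho> i s" using weight_pos[OF i] by simp
      then show "(ennreal (norm (f i s) powr p * \<rho> i s) = 0) = (f i s = 0)"
        by (auto simp: ennreal_eq_0_iff mult_le_0_iff not_le)
    qed
    finally show "(\<integral>\<^sup>+s. ennreal (norm (f i s) powr p * \<rho> i s) \<partial>unit_leb) = 0
       \<longleftrightarrow> (AE s in unit_leb. f i s = 0)" .
  qed simp
  finally show ?thesis .
qed

section \<open>Classes modulo null sets and their metric topology\<close>

lemma equiv_Lp_rel: "equiv (Lp_fun G \<rho> p) (Lp_rel G \<rho> p)"
proof (rule equivI)
  show "Lp_rel G \<rho> p \<subseteq> Lp_fun G \<rho> p \<times> Lp_fun G \<rho> p" by (auto simp: Lp_rel_def)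
  show "refl_on (Lp_fun G \<rho> p) (Lp_rel G \<rho> p)" by (auto simp: refl_on_def Lp_rel_def)
  show "sym (Lp_rel G \<rho> p)"
    by (rule symI) (simp add: Lp_rel_def eq_commute)
  show "trans (Lp_rel G \<rho> p)"
  proof (rule transI)
    fix f g h :: "'i \<Rightarrow> real \<Rightarrow> 'b"
    assume fg: "(f, g) \<in> Lp_rel G \<rho> p" and gh: "(g, h) \<in> Lp_rel G \<rho> p"
    have "AE s in unit_leb. f i s = h i s" if i: "i \<in> arcs G" for i
    proof -
      have "AE s in unit_leb. f i s = g i s" "AE s in unit_leb. g i s = h i s"
        using fg gh i by (auto simp: Lp_rel_def)
      then show ?thesis by eventually_elim simp
    qed
    then show "(f, h) \<in> Lp_rel G \<rho> p" using fg gh by (auto simp: Lp_rel_def)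
  qed
qed

lemma Lp_spaceD:
  assumes "X \<in> Lp_space G \<rho> p"
  shows "(SOME f. f \<in> X) \<in> X" "f \<in> X \<Longrightarrow> f \<in> Lp_fun G \<rho> p" "f \<in> X \<Longrightarrow> X = Lp_rel G \<rho> p `` {f}"
    "f \<in> X \<Longrightarrow> g \<in> X \<Longrightarrow> (f, g) \<in> Lp_rel G \<rho> p"
proof -
  have "X \<noteq> {}" using assms in_quotient_imp_non_empty[OF equiv_Lp_rel] by (auto simp: Lp_space_def)
  then show "(SOME f. f \<in> X) \<in> X" by (simp add: some_in_eq)
  show "f \<in> X \<Longrightarrow> f \<in> Lp_fun G \<rho> p"
    using assms in_quotient_imp_subset[OF equiv_Lp_rel] by (auto simp: Lp_space_def)
  show "X = Lp_rel G \<rho> p `` {f}" if "f \<in> X"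
  proof -
    obtain g where g: "X = Lp_rel G \<rho> p `` {g}" using assms by (auto simp: Lp_space_def elim: quotientE)
    with \<open>f \<in> X\<close> have "(g, f) \<in> Lp_rel G \<rho> p" by simp
    from equiv_class_eq[OF equiv_Lp_rel this] g show ?thesis by simp
  qed
  show "f \<in> X \<Longrightarrow> g \<in> X \<Longrightarrow> (f, g) \<in> Lp_rel G \<rho> p"
    using assms in_quotient_imp_in_rel[OF equiv_Lp_rel] by (auto simp: Lp_space_def)
qed

lemma Lp_class:
  assumes "f \<in> Lp_fun G \<rho> p"
  shows "Lp_rel G \<rho> p `` {f} \<in> Lp_space G \<rho> p" "f \<in> Lp_rel G \<rho> p `` {f}"
  using assms equiv_class_self[OF equiv_Lp_rel] by (auto simp: Lp_space_def quotientI)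

lemma Lp_dist_eq:
  assumes X: "X \<in> Lp_space G \<rho> p" "f \<in> X" and Y: "Y \<in> Lp_space G \<rho> p" "g \<in> Y"
  shows "Lp_dist G \<rho> p X Y = Lp_norm G \<rho> p (\<lambda>i s. f i s - g i s)"
proof -
  have "Lp_mass G \<rho> p (\<lambda>i s. (SOME f. f \<in> X) i s - (SOME g. g \<in> Y) i s) = Lp_mass G \<rho> p (\<lambda>i s. f i s - g i s)"
  proof (rule Lp_mass_cong_AE)
    fix i assume i: "i \<in> arcs G"
    have "AE s in unit_leb. (SOME f. f \<in> X) i s = f i s" "AE s in unit_leb. (SOME g. g \<in> Y) i s = g i s"
      using Lp_spaceD(4)[OF X(1) Lp_spaceD(1)[OF X(1)] X(2)] Lp_spaceD(4)[OF Y(1) Lp_spaceD(1)[OF Y(1)] Y(2)] i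
      by (auto simp: Lp_rel_def)
    then show "AE s in unit_leb. norm ((SOME f. f \<in> X) i s - (SOME g. g \<in> Y) i s) = norm (f i s - g i s)"
      by eventually_elim simp
  qed
  then show ?thesis by (simp add: Lp_dist_def Lp_norm_def)
qed

lemma Metric_space_Lp:
  "Metric_space (Lp_space G \<rho> p :: ('i \<Rightarrow> real \<Rightarrow> 'k::{real_normed_field, euclidean_space}) set set) (Lp_dist G \<rho> p)"
proof
  fix X Y Z :: "('i \<Rightarrow> real \<Rightarrow> 'k) set"
  show "0 \<le> Lp_dist G \<rho> p X Y" by (simp add: Lp_dist_def Lp_norm_nonneg)
  show "Lp_dist G \<rho> p X Y = Lp_dist G \<rho> p Y X"
    unfolding Lp_dist_def Lp_norm_def by (subst Lp_mass_minus_commute) simp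
  assume X: "X \<in> Lp_space G \<rho> p" and Y: "Y \<in> Lp_space G \<rho> p"
  define f where "f = (SOME f. f \<in> X)"
  define g where "g = (SOME g. g \<in> Y)"
  have f: "f \<in> X" "f \<in> Lp_fun G \<rho> p"
    using Lp_spaceD(1)[OF X] Lp_spaceD(2)[OF X Lp_spaceD(1)[OF X]] by (auto simp: f_def)
  have g: "g \<in> Y" "g \<in> Lp_fun G \<rho> p"
    using Lp_spaceD(1)[OF Y] Lp_spaceD(2)[OF Y Lp_spaceD(1)[OF Y]] by (auto simp: g_def)
  show "(Lp_dist G \<rho> p X Y = 0) = (X = Y)"
  proof -
    have "Lp_dist G \<rho> p X Y = 0 \<longleftrightarrow> (\<forall>i\<in>arcs G. AE s in unit_leb. f i s - g i s = 0)"
      unfolding Lp_dist_eq[OF X f(1) Y g(1)] by (rule Lp_norm_eq_0_iff[OF Lp_fun_diff[OF f(2) g(2)]])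
    also have "\<dots> \<longleftrightarrow> (f, g) \<in> Lp_rel G \<rho> p"
      unfolding Lp_rel_def mem_Collect_eq split_conv right_minus_eq using f(2) g(2) by blast
    also have "\<dots> \<longleftrightarrow> Lp_rel G \<rho> p `` {f} = Lp_rel G \<rho> p `` {g}"
      by (rule eq_equiv_class_iff[OF equiv_Lp_rel f(2) g(2), symmetric])
    also have "\<dots> \<longleftrightarrow> X = Y"
      by (simp only: Lp_spaceD(3)[OF X f(1), symmetric] Lp_spaceD(3)[OF Y g(1), symmetric])
    finally show ?thesis .
  qed
  assume Z: "Z \<in> Lp_space G \<rho> p"
  define h where "h = (SOME h. h \<in> Z)"
  have h: "h \<in> Z" "h \<in> Lp_fun G \<rho> p"
    using Lp_spaceD(1)[OF Z] Lp_spaceD(2)[OF Z Lp_spaceD(1)[OF Z]] by (auto simp: h_def)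
  show "Lp_dist G \<rho> p X Z \<le> Lp_dist G \<rho> p X Y + Lp_dist G \<rho> p Y Z"
    using Lp_fun_add(2)[OF Lp_fun_diff[OF f(2) g(2)] Lp_fun_diff[OF g(2) h(2)]]
    by (simp add: Lp_dist_eq[OF X f(1) Y g(1)] Lp_dist_eq[OF X f(1) Z h(1)] Lp_dist_eq[OF Y g(1) Z h(1)])
qed

text \<open>Reduces open sets of classes to functions and masses. The radius in terms of the mass is
  the p-th power of the metric radius.\<close>

lemma openin_Lp_topology_rep:
  assumes "openin (Lp_topology G \<rho> p) U" "X \<in> U" "f \<in> X"
  obtains r where "0 < r" "\<And>g. g \<in> Lp_fun G \<rho> p \<Longrightarrow> Lp_mass G \<rho> p (\<lambda>i s. g i s - f i s) < ennreal r
    \<Longrightarrow> Lp_rel G \<rho> p `` {g} \<in> U"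
proof -
  interpret M: Metric_space "Lp_space G \<rho> p" "Lp_dist G \<rho> p" by (rule Metric_space_Lp)
  obtain r where r: "r > 0" "M.mball X r \<subseteq> U" and X: "X \<in> Lp_space G \<rho> p"
    using assms(1,2) unfolding Lp_topology_def M.openin_mtopology by blast
  show thesis
  proof
    show "0 < r powr p" using r by simp
    fix g assume g: "g \<in> Lp_fun G \<rho> p" "Lp_mass G \<rho> p (\<lambda>i s. g i s - f i s) < ennreal (r powr p)"
    have d: "(\<lambda>i s. f i s - g i s) \<in> Lp_fun G \<rho> p"
      using Lp_fun_diff Lp_spaceD(2)[OF X assms(3)] g(1) by blast
    have "Lp_dist G \<rho> p X (Lp_rel G \<rho> p `` {g}) < r"
      unfolding Lp_dist_eq[OF X assms(3) Lp_class[OF g(1)]]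
      using d g(2) r by (subst Lp_norm_less_iff) (auto simp: Lp_fun_iff Lp_mass_minus_commute[of f])
    then show "Lp_rel G \<rho> p `` {g} \<in> U"
      using r(2) X Lp_class(1)[OF g(1)] by (auto simp: subset_iff)
  qed
qed

lemma Lp_topology_ball:
  assumes "f \<in> Lp_fun G \<rho> p" "0 < r"
  obtains U where "openin (Lp_topology G \<rho> p) U" "Lp_rel G \<rho> p `` {f} \<in> U" "U \<subseteq> Lp_space G \<rho> p"
    "\<And>X g. X \<in> U \<Longrightarrow> g \<in> X \<Longrightarrow> Lp_mass G \<rho> p (\<lambda>i s. g i s - f i s) < ennreal r"
proof -
  interpret M: Metric_space "Lp_space G \<rho> p" "Lp_dist G \<rho> p" by (rule Metric_space_Lp)
  define U where "U = M.mball (Lp_rel G \<rho> p `` {f}) (r powr (1 / p))"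
  show thesis
  proof
    show "openin (Lp_topology G \<rho> p) U" unfolding U_def Lp_topology_def by (rule M.openin_mball)
    show "Lp_rel G \<rho> p `` {f} \<in> U" unfolding U_def
      using Lp_class[OF assms(1)] assms(2) by (simp add: M.centre_in_mball_iff)
    show "U \<subseteq> Lp_space G \<rho> p" unfolding U_def by (rule M.mball_subset_mspace)
    fix X g assume X: "X \<in> U" "g \<in> X"
    then have XL: "X \<in> Lp_space G \<rho> p" and *: "Lp_dist G \<rho> p (Lp_rel G \<rho> p `` {f}) X < r powr (1 / p)"
      by (auto simp: U_def)
    have d: "(\<lambda>i s. f i s - g i s) \<in> Lp_fun G \<rho> p"
      using Lp_fun_diff[OF assms(1) Lp_spaceD(2)[OF XL X(2)]] .
    have "Lp_mass G \<rho> p (\<lambda>i s. f i s - g i s) < ennreal ((r powr (1 / p)) powr p)"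
      using * d unfolding Lp_dist_eq[OF Lp_class[OF assms(1)] XL X(2)]
      by (subst Lp_norm_less_iff[symmetric]) (auto simp: Lp_fun_iff)
    then show "Lp_mass G \<rho> p (\<lambda>i s. g i s - f i s) < ennreal r"
      using assms(2) p by (simp add: powr_powr Lp_mass_minus_commute[of f])
  qed
qed

end

section \<open>Absolute continuity of the weights and truncation\<close>

text \<open>Absolute continuity of the integral: the part of w above height n has small integral by
  dominated convergence, and the rest contributes at most n times the measure of the set.\<close>

lemma nn_integral_small_on_small_sets:
  fixes w :: "'a \<Rightarrow> ennreal"
  assumes [measurable]: "w \<in> borel_measurable M" and fin: "(\<integral>\<^sup>+x. w x \<partial>M) < \<infinity>" and "0 < \<eta>"
  obtains \<delta> :: real where "0 < \<delta>"
    "\<And>B. B \<in> sets M \<Longrightarrow> emeasure M B \<le> ennreal \<delta> \<Longrightarrow> (\<integral>\<^sup>+x\<in>B. w x \<partial>M) \<le> ennreal \<eta>"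
proof -
  define u where "u n x = (if w x \<le> of_nat n then 0 else w x)" for n x
  have [measurable]: "u n \<in> borel_measurable M" for n unfolding u_def by measurable
  have "(\<lambda>n. \<integral>\<^sup>+x. u n x \<partial>M) \<longlonglongrightarrow> (\<integral>\<^sup>+x. 0 \<partial>M)"
  proof (rule nn_integral_dominated_convergence[where w = w])
    have "AE x in M. w x \<noteq> \<infinity>" using fin by (intro nn_integral_PInf_AE) auto
    then show "AE x in M. (\<lambda>n. u n x) \<longlonglongrightarrow> 0"
    proof eventually_elim
      fix x assume "w x \<noteq> \<infinity>"
      then obtain N where N: "w x \<le> of_nat N"
        by (metis ennreal_Ex_less_of_nat infinity_ennreal_def less_imp_le top.not_eq_extremum)
      have "u n x = 0" if "N \<le> n" for n
        using order_trans[OF N, of "of_nat n"] that by (simp add: u_def)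
      then show "(\<lambda>n. u n x) \<longlonglongrightarrow> 0"
        by (intro tendsto_eventually) (auto simp: eventually_sequentially)
    qed
  qed (use fin in \<open>auto simp: u_def\<close>)
  then have "\<forall>\<^sub>F n in sequentially. (\<integral>\<^sup>+x. u n x \<partial>M) < ennreal (\<eta> / 2)"
    using assms(3) by (intro order_tendstoD) auto
  then obtain n where n: "(\<integral>\<^sup>+x. u n x \<partial>M) < ennreal (\<eta> / 2)"
    by (auto simp: eventually_sequentially)
  show thesis
  proof
    \<comment> \<open>With this bound on the measure the part below height n contributes at most
      half of \<eta>; the summand 1 covers n = 0.\<close>
    show "0 < \<eta> / (2 * (real n + 1))" using assms(3) by simp
    fix B assume [measurable]: "B \<in> sets M" and B: "emeasure M B \<le> ennreal (\<eta> / (2 * (real n + 1)))"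
    have "(\<integral>\<^sup>+x\<in>B. w x \<partial>M) \<le> (\<integral>\<^sup>+x. (u n x + of_nat n * indicator B x) \<partial>M)"
      by (intro nn_integral_mono) (auto simp: u_def split: split_indicator)
    also have "\<dots> = (\<integral>\<^sup>+x. u n x \<partial>M) + of_nat n * emeasure M B"
      by (simp add: nn_integral_add nn_integral_cmult)
    also have "\<dots> \<le> ennreal (\<eta> / 2) + ennreal (real n) * ennreal (\<eta> / (2 * (real n + 1)))"
      using n B by (intro add_mono mult_mono) (auto simp: ennreal_of_nat_eq_real_of_nat)
    also have "\<dots> = ennreal (\<eta> / 2 + real n * (\<eta> / (2 * (real n + 1))))"
      using assms(3) by (simp add: ennreal_mult'[symmetric] ennreal_plus[symmetric] del: ennreal_plus)
    also have "\<dots> \<le> ennreal \<eta>"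
      using assms(3) by (intro ennreal_leI) (simp add: field_simps)
    finally show "(\<integral>\<^sup>+x\<in>B. w x \<partial>M) \<le> ennreal \<eta>" .
  qed
qed

text \<open>The converse absolute continuity, which rests on strict positivity of w. The sets where
  w < 1/(n+1) decrease to the empty set, so in a finite measure space one of them is small; off it
  the measure is at most n+1 times the integral of w.\<close>

lemma (in finite_measure) emeasure_small_if_nn_integral_small:
  fixes w :: "'a \<Rightarrow> real"
  assumes [measurable]: "w \<in> borel_measurable M" and pos: "\<And>x. x \<in> space M \<Longrightarrow> 0 < w x" and "0 < \<eta>"
  obtains \<delta> :: real where "0 < \<delta>"
    "\<And>B. B \<in> sets M \<Longrightarrow> (\<integral>\<^sup>+x\<in>B. ennreal (w x) \<partial>M) \<le> ennreal \<delta> \<Longrightarrow> emeasure M B \<le> ennreal \<eta>"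
proof -
  define A where "A n = {x \<in> space M. w x < 1 / (real n + 1)}" for n
  have [measurable]: "A n \<in> sets M" for n unfolding A_def by measurable
  have "(\<lambda>n. emeasure M (A n)) \<longlonglongrightarrow> emeasure M (\<Inter>n. A n)"
  proof (rule Lim_emeasure_decseq)
    show "decseq A"
      unfolding decseq_def A_def by (auto elim!: order.strict_trans2 intro!: divide_left_mono)
  qed auto
  also have "(\<Inter>n. A n) = {}"
  proof -
    have "\<exists>n. x \<notin> A n" if "x \<in> space M" for x
      using reals_Archimedean[OF pos[OF that]]
      by (auto simp: A_def inverse_eq_divide not_less add.commute intro: less_imp_le)
    then show ?thesis by (auto simp: A_def)
  qed
  finally have "\<forall>\<^sub>F n in sequentially. emeasure M (A n) < ennreal (\<eta> / 2)"
    using assms(3) by (intro order_tendstoD) auto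
  then obtain n where n: "emeasure M (A n) < ennreal (\<eta> / 2)"
    by (auto simp: eventually_sequentially)
  show thesis
  proof
    show "0 < \<eta> / (2 * (real n + 1))" using assms(3) by simp
    fix B assume [measurable]: "B \<in> sets M"
      and B: "(\<integral>\<^sup>+x\<in>B. ennreal (w x) \<partial>M) \<le> ennreal (\<eta> / (2 * (real n + 1)))"
    have "emeasure M B = (\<integral>\<^sup>+x. indicator B x \<partial>M)" by simp
    also have "\<dots> \<le> (\<integral>\<^sup>+x. (indicator (A n) x + ennreal (real n + 1) * (ennreal (w x) * indicator B x)) \<partial>M)"
    proof (rule nn_integral_mono)
      fix x assume x: "x \<in> space M"
      show "indicator B x \<le> indicator (A n) x + ennreal (real n + 1) * (ennreal (w x) * indicator B x)"
      proof (cases "x \<in> A n \<or> x \<notin> B")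
        case False
        then have "1 \<le> (real n + 1) * w x" using x by (auto simp: A_def field_simps)
        then have "ennreal 1 \<le> ennreal (real n + 1) * ennreal (w x)"
          using pos[OF x] by (simp add: ennreal_mult'[symmetric] del: ennreal_1 ennreal_plus)
        then show ?thesis using False by simp
      qed (auto simp: indicator_def)
    qed
    also have "\<dots> = emeasure M (A n) + ennreal (real n + 1) * (\<integral>\<^sup>+x\<in>B. ennreal (w x) \<partial>M)"
      by (simp add: nn_integral_add nn_integral_cmult del: ennreal_plus)
    also have "\<dots> \<le> ennreal (\<eta> / 2) + ennreal (real n + 1) * ennreal (\<eta> / (2 * (real n + 1)))"
      using n B by (intro add_mono mult_left_mono) auto
    also have "\<dots> = ennreal (\<eta> / 2 + (real n + 1) * (\<eta> / (2 * (real n + 1))))"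
      using assms(3) by (simp add: ennreal_mult'[symmetric] ennreal_plus[symmetric] del: ennreal_plus)
    also have "\<eta> / 2 + (real n + 1) * (\<eta> / (2 * (real n + 1))) = \<eta>"
      by (simp add: divide_simps) (simp add: algebra_simps)
    finally show "emeasure M B \<le> ennreal \<eta>" .
  qed
qed

lemma emeasure_unit_leb: "emeasure unit_leb {0..<1} = 1"
  by (simp add: emeasure_restrict_space)

lemma finite_measure_unit_leb: "finite_measure unit_leb"
  by (rule finite_measureI) (simp add: emeasure_unit_leb)

context weighted_tree
begin

lemma weight_nn_integral_finite: "i \<in> arcs G \<Longrightarrow> (\<integral>\<^sup>+s. ennreal (\<rho> i s) \<partial>unit_leb) < \<infinity>"
proof -
  assume i: "i \<in> arcs G"
  have "(\<integral>\<^sup>+s. ennreal (\<rho> i s) \<partial>unit_leb) \<le> (\<integral>\<^sup>+s. ennreal (norm (\<rho> i s)) \<partial>unit_leb)"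
    by (intro nn_integral_mono ennreal_leI) simp
  also have "\<dots> < \<infinity>" using weight_integrable[OF i] by (simp add: integrable_iff_bounded)
  finally show ?thesis .
qed

text \<open>Both truncations are needed later: the finite support is eventually annihilated by the
  semigroup, and the bound C controls the cost of a perturbation. Dominated convergence is applied
  on each edge and then to the sum over edges.\<close>

lemma Lp_approx:
  fixes f :: "'i \<Rightarrow> real \<Rightarrow> 'k::{real_normed_field, euclidean_space}"
  assumes f: "f \<in> Lp_fun G \<rho> p" and "0 < r"
  obtains K C f0 where "finite K" "K \<subseteq> arcs G" "0 < C" "f0 \<in> Lp_fun G \<rho> p"
    "\<And>i s. norm (f0 i s) \<le> C" "\<And>i s. i \<notin> K \<Longrightarrow> f0 i s = 0"
    "Lp_mass G \<rho> p (\<lambda>i s. f0 i s - f i s) < ennreal r"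
proof -
  define K where "K n = {j \<in> arcs G. to_nat_on (arcs G) j < n}" for n
  \<comment> \<open>Large values are replaced by 0 instead of being clipped, so the error is 0 or -f
    and is dominated by f itself.\<close>
  define h where "h n j s = (if j \<in> K n \<and> norm (f j s) \<le> real n then f j s else 0)" for n j s
  have fm: "Lp_meas f" "Lp_mass G \<rho> p f < \<infinity>" using f by (auto simp: Lp_fun_iff)
  have hm: "Lp_meas (h n)" for n
    unfolding Lp_meas_def
  proof
    fix i assume "i \<in> arcs G"
    note [measurable] = Lp_measD[OF fm(1) this]
    show "h n i \<in> borel_measurable unit_leb" unfolding h_def by measurable
  qed
  have hf: "h n \<in> Lp_fun G \<rho> p" for n
  proof -
    have "Lp_mass G \<rho> p (h n) \<le> Lp_mass G \<rho> p f"
      by (rule Lp_mass_mono) (simp add: h_def)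
    then show ?thesis using hm fm by (auto simp: Lp_fun_iff intro: le_less_trans)
  qed
  let ?w = "\<lambda>j s. ennreal (norm (f j s) powr p * \<rho> j s)"
  let ?u = "\<lambda>n j s. ennreal (norm (h n j s - f j s) powr p * \<rho> j s)"
  have le: "?u n j s \<le> ?w j s" if "j \<in> arcs G" "s \<in> {0..<1}" for n j s
    using weight_pos[OF that] by (auto simp: h_def)
  have fin: "(\<integral>\<^sup>+s. ?w j s \<partial>unit_leb) < \<infinity>" if "j \<in> arcs G" for j
    using fm(2) that unfolding Lp_mass_nn_integral
    by (meson le_less_trans nn_integral_ge_point)
  have "(\<lambda>n. \<integral>\<^sup>+j. \<integral>\<^sup>+s. ?u n j s \<partial>unit_leb \<partial>count_space (arcs G)) \<longlonglongrightarrow> (\<integral>\<^sup>+j. 0 \<partial>count_space (arcs G))"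
  proof (rule nn_integral_dominated_convergence[where w = "\<lambda>j. \<integral>\<^sup>+s. ?w j s \<partial>unit_leb"])
    show "AE j in count_space (arcs G). (\<integral>\<^sup>+s. ?u n j s \<partial>unit_leb) \<le> (\<integral>\<^sup>+s. ?w j s \<partial>unit_leb)" for n
      unfolding AE_count_space using le by (intro ballI nn_integral_mono) auto
    show "(\<integral>\<^sup>+j. \<integral>\<^sup>+s. ?w j s \<partial>unit_leb \<partial>count_space (arcs G)) < \<infinity>"
      using fm(2) by (simp add: Lp_mass_nn_integral)
    show "AE j in count_space (arcs G). (\<lambda>n. \<integral>\<^sup>+s. ?u n j s \<partial>unit_leb) \<longlonglongrightarrow> 0"
      unfolding AE_count_space
    proof
      fix j assume j: "j \<in> arcs G"
      have "(\<lambda>n. \<integral>\<^sup>+s. ?u n j s \<partial>unit_leb) \<longlonglongrightarrow> (\<integral>\<^sup>+s. 0 \<partial>unit_leb)"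
      proof (rule nn_integral_dominated_convergence[where w = "?w j"])
        show "?u n j \<in> borel_measurable unit_leb" for n
          using Lp_meas_integrand[OF Lp_meas_diff[OF hm fm(1)] j] .
        show "AE s in unit_leb. (\<lambda>n. ?u n j s) \<longlonglongrightarrow> 0"
        proof (rule AE_I2)
          fix s assume "s \<in> space unit_leb"
          obtain N where N: "norm (f j s) \<le> real N" using real_arch_simple by blast
          have "?u n j s = 0" if "max N (Suc (to_nat_on (arcs G) j)) \<le> n" for n
            using that N j by (auto simp: h_def K_def)
          then show "(\<lambda>n. ?u n j s) \<longlonglongrightarrow> 0"
            by (intro tendsto_eventually) (auto simp: eventually_sequentially simp del: max.bounded_iff)
        qed
      qed (use le j Lp_meas_integrand[OF fm(1) j] fin[OF j] in \<open>auto intro!: AE_I2\<close>)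
      then show "(\<lambda>n. \<integral>\<^sup>+s. ?u n j s \<partial>unit_leb) \<longlonglongrightarrow> 0" by simp
    qed
  qed auto
  then have "\<forall>\<^sub>F n in sequentially. (\<integral>\<^sup>+j. \<integral>\<^sup>+s. ?u n j s \<partial>unit_leb \<partial>count_space (arcs G)) < ennreal r"
    using assms(2) by (intro order_tendstoD) auto
  then obtain n where n: "Lp_mass G \<rho> p (\<lambda>i s. h n i s - f i s) < ennreal r"
    unfolding Lp_mass_nn_integral by (auto simp: eventually_sequentially)
  \<comment> \<open>The bound is n + 1 because C has to be positive even when n = 0.\<close>
  show thesis
  proof (rule that[of "K n" "real n + 1" "h n"])
    have "inj_on (to_nat_on (arcs G)) (K n)" "to_nat_on (arcs G) ` K n \<subseteq> {..<n}"
      by (auto simp: K_def intro: inj_on_subset[OF inj_on_to_nat_on[OF countable_arcs]])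
    then show "finite (K n)" by (meson finite_imageD finite_lessThan finite_subset)
  qed (use hf n in \<open>auto simp: h_def K_def\<close>)
qed

section \<open>The translation operators on classes\<close>

text \<open>As there are countably many arcs, a single null set works for all of them, and its
  preimage under the rotation is again null.\<close>

lemma left_shift_cong_AE:
  assumes "(f, f') \<in> Lp_rel G \<rho> p" "i \<in> arcs G" "0 \<le> t"
  shows "AE s in unit_leb. left_shift_fun G t f i s = left_shift_fun G t f' i s"
proof -
  have "AE s in unit_leb. \<forall>j\<in>arcs G. f j s = f' j s"
    using assms(1) by (subst AE_ball_countable) (auto simp: Lp_rel_def)
  from AE_shift_pos[OF assms(3) this] show ?thesis
  proof eventually_elim
    fix s assume "\<forall>j\<in>arcs G. f j (shift_pos t s) = f' j (shift_pos t s)"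
    then show "left_shift_fun G t f i s = left_shift_fun G t f' i s"
      unfolding left_shift_fun_def using succ_arcs_subset[OF assms(2)] by (intro infsum_cong) blast
  qed
qed

text \<open>The union in \<open>left_shift\<close> runs over all representatives. One whose shift
  leaves \<open>Lp_fun\<close> contributes nothing, and all others contribute the same
  class.\<close>

lemma left_shift_class:
  assumes f: "f \<in> Lp_fun G \<rho> p" "left_shift_fun G t f \<in> Lp_fun G \<rho> p" and t: "0 \<le> t"
  shows "left_shift G \<rho> p t (Lp_rel G \<rho> p `` {f}) = Lp_rel G \<rho> p `` {left_shift_fun G t f}"
proof
  show "Lp_rel G \<rho> p `` {left_shift_fun G t f} \<subseteq> left_shift G \<rho> p t (Lp_rel G \<rho> p `` {f})"
    using Lp_class(2)[OF f(1)] by (auto simp: left_shift_def)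
  show "left_shift G \<rho> p t (Lp_rel G \<rho> p `` {f}) \<subseteq> Lp_rel G \<rho> p `` {left_shift_fun G t f}"
  proof
    fix g assume "g \<in> left_shift G \<rho> p t (Lp_rel G \<rho> p `` {f})"
    then obtain f' where f': "(f, f') \<in> Lp_rel G \<rho> p" "(left_shift_fun G t f', g) \<in> Lp_rel G \<rho> p"
      by (auto simp: left_shift_def)
    then have "left_shift_fun G t f' \<in> Lp_fun G \<rho> p" by (simp add: Lp_rel_def)
    then have "(left_shift_fun G t f, left_shift_fun G t f') \<in> Lp_rel G \<rho> p"
      unfolding Lp_rel_def using f left_shift_cong_AE[OF f'(1) _ t] by simp
    with f'(2) have "(left_shift_fun G t f, g) \<in> Lp_rel G \<rho> p"
      using equiv_Lp_rel by (meson equivE transE)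
    then show "g \<in> Lp_rel G \<rho> p `` {left_shift_fun G t f}" by simp
  qed
qed

text \<open>A member of the space of classes is nonempty, so some representative contributes to the
  union; contributing forces its shift into \<open>Lp_fun\<close>.\<close>

lemma left_shift_rep:
  assumes "left_shift G \<rho> p t X \<in> Lp_space G \<rho> p"
  obtains f where "f \<in> X" "left_shift_fun G t f \<in> left_shift G \<rho> p t X"
proof -
  obtain g where g: "g \<in> left_shift G \<rho> p t X" using Lp_spaceD(1)[OF assms] by blast
  then obtain f where f: "f \<in> X" "(left_shift_fun G t f, g) \<in> Lp_rel G \<rho> p"
    by (auto simp: left_shift_def)
  then have "left_shift_fun G t f \<in> Lp_fun G \<rho> p" by (simp add: Lp_rel_def)
  from Lp_class(2)[OF this] f(1) have "left_shift_fun G t f \<in> left_shift G \<rho> p t X"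
    by (auto simp: left_shift_def)
  with f(1) that show ?thesis by blast
qed

end

section \<open>Recurrence forces small times\<close>

lemma borel_measurable_nn_integral_count_space:
  fixes f :: "'j \<Rightarrow> 'a \<Rightarrow> ennreal"
  assumes "countable A" and [measurable]: "\<And>j. j \<in> A \<Longrightarrow> f j \<in> borel_measurable M"
  shows "(\<lambda>x. \<integral>\<^sup>+j. f j x \<partial>count_space A) \<in> borel_measurable M"
proof (cases "finite A")
  case True
  then show ?thesis by (simp add: nn_integral_count_space_finite)
next
  case False
  have b: "bij_betw (from_nat_into A) UNIV A" by (rule bij_betw_from_nat_into[OF assms(1) False])
  have [measurable]: "f (from_nat_into A n) \<in> borel_measurable M" for n
    using b by (intro assms(2)) (auto simp: bij_betw_def)
  show ?thesis
    by (simp add: nn_integral_bij_count_space[OF b, symmetric] nn_integral_count_space_nat)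
qed

lemma nn_integral_lebesgue_unit_leb:
  assumes "E \<subseteq> {0..<1}"
  shows "(\<integral>\<^sup>+s\<in>E. F s \<partial>lebesgue) = (\<integral>\<^sup>+s\<in>E. F s \<partial>unit_leb)"
proof -
  have "(\<integral>\<^sup>+s\<in>E. F s \<partial>lebesgue) = (\<integral>\<^sup>+s\<in>{0..<1}. F s * indicator E s \<partial>lebesgue)"
    using assms by (intro nn_integral_cong) (auto split: split_indicator)
  also have "\<dots> = (\<integral>\<^sup>+s\<in>E. F s \<partial>unit_leb)"
    by (subst nn_integral_restrict_space) auto
  finally show ?thesis .
qed

context weighted_tree
begin

text \<open>Rotation invariance on every edge, followed by Tonelli's theorem. The mass is thus
  organised by s, with all edges read at the coordinate that the operator uses; pointwise estimates
  in s can then be integrated.\<close>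

lemma Lp_mass_shift:
  assumes "Lp_meas f" "0 \<le> t"
  shows "Lp_mass G \<rho> p f = (\<integral>\<^sup>+s. \<integral>\<^sup>+j. ennreal (norm (f j (shift_pos t s)) powr p * \<rho> j (shift_pos t s))
      \<partial>count_space (arcs G) \<partial>unit_leb)"
proof -
  have "Lp_mass G \<rho> p f = (\<integral>\<^sup>+j. \<integral>\<^sup>+s. ennreal (norm (f j (shift_pos t s)) powr p * \<rho> j (shift_pos t s))
      \<partial>unit_leb \<partial>count_space (arcs G))"
    unfolding Lp_mass_nn_integral
  proof (rule nn_integral_cong)
    fix j assume "j \<in> space (count_space (arcs G))"
    then show "(\<integral>\<^sup>+s. ennreal (norm (f j s) powr p * \<rho> j s) \<partial>unit_leb)
      = (\<integral>\<^sup>+s. ennreal (norm (f j (shift_pos t s)) powr p * \<rho> j (shift_pos t s)) \<partial>unit_leb)"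
      using nn_integral_shift_pos[OF assms(2) Lp_meas_integrand[OF assms(1)], of j] by simp
  qed
  also have "\<dots> = (\<integral>\<^sup>+s. \<integral>\<^sup>+j. ennreal (norm (f j (shift_pos t s)) powr p * \<rho> j (shift_pos t s))
      \<partial>count_space (arcs G) \<partial>unit_leb)"
    using measurable_compose[OF measurable_shift_pos[OF assms(2)] Lp_meas_integrand[OF assms(1)]]
    by (intro nn_integral_count_space_nn_integral[symmetric]) auto
  finally show ?thesis .
qed

lemma Phi_left_shift_le:
  fixes u :: "'i \<Rightarrow> real \<Rightarrow> 'k::{real_normed_field, euclidean_space}"
  assumes i: "i \<in> arcs G" and t: "0 \<le> t" and s: "s \<in> {0..<1}"
  shows "Phi G \<rho> p i t s * ennreal (norm (left_shift_fun G t u i s) powr p)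
    \<le> (\<integral>\<^sup>+j. ennreal (norm (u j (shift_pos t s)) powr p * \<rho> j (shift_pos t s))
         \<partial>count_space (succ_arcs G (shift_n t s) i))"
  unfolding Phi_def left_shift_fun_def dual_weight_sum_def
proof (rule epowr_infsum_le)
  show "countable (succ_arcs G (shift_n t s) i)"
    using succ_arcs_subset[OF i] countable_arcs by (rule countable_subset)
  show "0 < \<rho> j (shift_pos t s)" if "j \<in> succ_arcs G (shift_n t s) i" for j
    using weight_pos[OF _ shift_pos_in[OF t s]] that succ_arcs_subset[OF i] by blast
qed (rule p)

definition indicator_family :: "'i set \<Rightarrow> 'i \<Rightarrow> real \<Rightarrow> 'k::{real_normed_field, euclidean_space}" where
  "indicator_family K i s = (if i \<in> K then 1 else 0)"

lemma indicator_family_Lp: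
  assumes K: "finite K" "K \<subseteq> arcs G"
  shows "(indicator_family K :: 'i \<Rightarrow> real \<Rightarrow> 'k::{real_normed_field, euclidean_space}) \<in> Lp_fun G \<rho> p"
proof -
  have "Lp_mass G \<rho> p (indicator_family K :: _ \<Rightarrow> _ \<Rightarrow> 'k)
      = (\<integral>\<^sup>+i. (\<integral>\<^sup>+s. ennreal (norm (indicator_family K i s :: 'k) powr p * \<rho> i s) \<partial>unit_leb) \<partial>count_space K)"
    unfolding Lp_mass_nn_integral using K
    by (intro nn_integral_count_space_eq) (auto simp: indicator_family_def)
  also have "\<dots> = (\<Sum>i\<in>K. \<integral>\<^sup>+s. ennreal (\<rho> i s) \<partial>unit_leb)"
    using K by (simp add: nn_integral_count_space_finite indicator_family_def)
  also have "\<dots> < \<infinity>" using K weight_nn_integral_finite by (auto simp: subset_iff)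
  finally have "Lp_mass G \<rho> p (indicator_family K :: _ \<Rightarrow> _ \<Rightarrow> 'k) < \<infinity>" .
  moreover have "(indicator_family K i :: real \<Rightarrow> 'k) = (\<lambda>s. if i \<in> K then 1 else 0)" for i
    by (simp add: fun_eq_iff indicator_family_def)
  ultimately show ?thesis by (simp add: Lp_fun_iff Lp_meas_def)
qed

text \<open>The radius r depends on K, \<epsilon> and \<alpha> but not on t or u. This uniformity
  allows one neighbourhood of the indicator to be fixed before its return times are
  examined.\<close>

lemma recurrence_small_times:
  assumes K: "finite K" "K \<noteq> {}" "K \<subseteq> arcs G" and "0 < \<epsilon>" and \<alpha>: "0 < \<alpha>" "\<alpha> < 1"
  obtains r where "0 < r"
    "\<And>t (u :: 'i \<Rightarrow> real \<Rightarrow> 'k::{real_normed_field, euclidean_space}). 0 \<le> t \<Longrightarrow> u \<in> Lp_fun G \<rho> p \<Longrightarrow> left_shift_fun G t u \<in> Lp_fun G \<rho> p \<Longrightarrow>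
      (\<And>i s. i \<in> K \<Longrightarrow> s \<in> {0..<1} \<Longrightarrow> succ_arcs G (shift_n t s) i \<inter> K = {}) \<Longrightarrow>
      Lp_mass G \<rho> p (\<lambda>i s. u i s - indicator_family K i s) < ennreal r \<Longrightarrow>
      Lp_mass G \<rho> p (\<lambda>i s. left_shift_fun G t u i s - indicator_family K i s) < ennreal r \<Longrightarrow>
      t \<in> small_times G \<rho> p K \<epsilon> \<alpha>"
proof -
  define k where "k = real (card K)"
  have k: "0 < k" using K by (simp add: k_def card_gt_0_iff)
  \<comment> \<open>Each of the k exceptional sets will have measure at most \<eta>, so together
    they take at most half of 1 - \<alpha>.\<close>
  define \<eta> where "\<eta> = (1 - \<alpha>) / (2 * k)"
  have \<eta>: "0 < \<eta>" using \<alpha> k by (simp add: \<eta>_def)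
  have "\<exists>\<delta>>0. \<forall>B\<in>sets unit_leb. (\<integral>\<^sup>+s\<in>B. ennreal (\<rho> i s) \<partial>unit_leb) \<le> ennreal \<delta> \<longrightarrow> emeasure unit_leb B \<le> ennreal \<eta>"
    if "i \<in> K" for i
  proof -
    have "i \<in> arcs G" using that K by blast
    then have "\<And>s. s \<in> space unit_leb \<Longrightarrow> 0 < \<rho> i s" using weight_pos by simp
    from finite_measure.emeasure_small_if_nn_integral_small[OF finite_measure_unit_leb
        weight_measurable[OF \<open>i \<in> arcs G\<close>] this \<eta>]
    obtain \<delta> :: real where "0 < \<delta>" "\<And>B. B \<in> sets unit_leb \<Longrightarrow>
        (\<integral>\<^sup>+s\<in>B. ennreal (\<rho> i s) \<partial>unit_leb) \<le> ennreal \<delta> \<Longrightarrow> emeasure unit_leb B \<le> ennreal \<eta>"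
      by blast
    then show ?thesis by blast
  qed
  then obtain \<delta> where \<delta>: "\<And>i. i \<in> K \<Longrightarrow> 0 < \<delta> i"
    "\<And>i B. i \<in> K \<Longrightarrow> B \<in> sets unit_leb \<Longrightarrow> (\<integral>\<^sup>+s\<in>B. ennreal (\<rho> i s) \<partial>unit_leb) \<le> ennreal (\<delta> i)
       \<Longrightarrow> emeasure unit_leb B \<le> ennreal \<eta>"
    by metis
  \<comment> \<open>The first entry serves Chebyshev's inequality at height 1/2 on every edge of K;
    the second absorbs the factor \<open>2 powr p * k\<close> of the final estimate.\<close>
  define r where "r = min (Min (\<delta> ` K) / 2 powr p) (\<epsilon> / (2 powr p * k))"
  have r: "0 < r" using \<delta>(1) K k assms(4) by (simp add: r_def)
  have r1: "2 powr p * r \<le> \<delta> i" if "i \<in> K" for i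
  proof -
    have "2 powr p * r \<le> 2 powr p * (Min (\<delta> ` K) / 2 powr p)"
      by (intro mult_left_mono) (auto simp: r_def)
    also have "\<dots> \<le> \<delta> i" using K that by simp
    finally show ?thesis .
  qed
  have r2: "2 powr p * k * r \<le> \<epsilon>"
  proof -
    have "2 powr p * k * r \<le> 2 powr p * k * (\<epsilon> / (2 powr p * k))"
      using k by (intro mult_left_mono) (auto simp: r_def)
    also have "\<dots> = \<epsilon>" using k by simp
    finally show ?thesis .
  qed
  show thesis
  proof (rule that[OF r])
    fix t and u :: "'i \<Rightarrow> real \<Rightarrow> 'k"
    assume t: "0 \<le> t" and u: "u \<in> Lp_fun G \<rho> p" and Tu: "left_shift_fun G t u \<in> Lp_fun G \<rho> p"
      and away: "\<And>i s. i \<in> K \<Longrightarrow> s \<in> {0..<1} \<Longrightarrow> succ_arcs G (shift_n t s) i \<inter> K = {}"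
      and u1: "Lp_mass G \<rho> p (\<lambda>i s. u i s - indicator_family K i s) < ennreal r"
      and Tu1: "Lp_mass G \<rho> p (\<lambda>i s. left_shift_fun G t u i s - indicator_family K i s) < ennreal r"
    define v where "v = left_shift_fun G t u"
    have v: "Lp_meas v" using Tu by (simp add: v_def Lp_fun_iff)
    \<comment> \<open>On this set \<open>v i\<close> differs from 1 by at least 1/2, so its weighted
      measure is at most \<open>2 powr p * r\<close>. The positive weight then makes its Lebesgue
      measure small.\<close>
    define B where "B i = {s \<in> space unit_leb. norm (v i s) < 1 / 2}" for i
    have Bm: "B i \<in> sets unit_leb" if "i \<in> K" for i
    proof -
      have [measurable]: "v i \<in> borel_measurable unit_leb" using Lp_measD[OF v] K that by blast
      show ?thesis unfolding B_def by measurable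
    qed
    have B: "emeasure unit_leb (B i) \<le> ennreal \<eta>" if i: "i \<in> K" for i
    proof (rule \<delta>(2)[OF i Bm[OF i]])
      have iG: "i \<in> arcs G" using i K by blast
      have "(\<integral>\<^sup>+s\<in>B i. ennreal (\<rho> i s) \<partial>unit_leb)
          \<le> (\<integral>\<^sup>+s. ennreal (2 powr p) * ennreal (norm (v i s - indicator_family K i s) powr p * \<rho> i s) \<partial>unit_leb)"
      proof (rule nn_integral_mono)
        fix s assume s: "s \<in> space unit_leb"
        have r0: "0 < \<rho> i s" using weight_pos[OF iG] s by simp
        show "ennreal (\<rho> i s) * indicator (B i) s
          \<le> ennreal (2 powr p) * ennreal (norm (v i s - indicator_family K i s) powr p * \<rho> i s)"
        proof (cases "s \<in> B i")
          case True
          then have "1 / 2 \<le> norm (v i s - 1)"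
            using norm_triangle_ineq2[of 1 "v i s"] by (simp add: B_def norm_minus_commute)
          then have "1 \<le> (2 * norm (v i s - 1)) powr p"
            using p by (intro ge_one_powr_ge_zero) auto
          then have "\<rho> i s \<le> 2 powr p * (norm (v i s - 1) powr p * \<rho> i s)"
            using r0 by (simp add: powr_mult mult.assoc[symmetric])
          then show ?thesis using True r0 i
            by (simp add: ennreal_mult'[symmetric] indicator_family_def)
        qed simp
      qed
      also have "\<dots> = ennreal (2 powr p) * (\<integral>\<^sup>+s. ennreal (norm (v i s - indicator_family K i s) powr p * \<rho> i s) \<partial>unit_leb)"
        using Lp_meas_integrand[OF Lp_meas_diff[OF v] iG] indicator_family_Lp[OF K(1,3)]
        by (intro nn_integral_cmult) (auto simp: Lp_fun_iff)
      also have "\<dots> \<le> ennreal (2 powr p) * Lp_mass G \<rho> p (\<lambda>i s. v i s - indicator_family K i s)"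
        unfolding Lp_mass_nn_integral by (intro mult_left_mono nn_integral_ge_point iG) simp
      also have "\<dots> \<le> ennreal (2 powr p) * ennreal r"
        using Tu1 by (intro mult_left_mono) (auto simp: v_def)
      also have "\<dots> \<le> ennreal (\<delta> i)"
        using r1[OF i] r by (simp add: ennreal_mult'[symmetric] ennreal_leI)
      finally show "(\<integral>\<^sup>+s\<in>B i. ennreal (\<rho> i s) \<partial>unit_leb) \<le> ennreal (\<delta> i)" .
    qed
    define E where "E = {0..<1} - (\<Union>i\<in>K. B i)"
    have BU: "(\<Union>i\<in>K. B i) \<in> sets unit_leb" using Bm K(1) by (intro sets.finite_UN)
    have Em: "E \<in> sets unit_leb" unfolding E_def using BU by (metis sets.compl_sets space_lebesgue_on)
    then have E: "E \<in> sets lebesgue" "E \<subseteq> {0..<1}" by (auto simp: sets_restrict_space_iff)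
    have "emeasure unit_leb (\<Union>i\<in>K. B i) \<le> (\<Sum>i\<in>K. emeasure unit_leb (B i))"
      using Bm K by (intro emeasure_subadditive_finite) auto
    also have "\<dots> \<le> (\<Sum>i\<in>K. ennreal \<eta>)" by (intro sum_mono B)
    also have "\<dots> = ennreal (k * \<eta>)"
      using \<eta> by (simp add: k_def ennreal_mult' ennreal_of_nat_eq_real_of_nat)
    also have "k * \<eta> = (1 - \<alpha>) / 2" using k by (simp add: \<eta>_def)
    finally have "measure unit_leb (\<Union>i\<in>K. B i) \<le> (1 - \<alpha>) / 2"
      using \<alpha> finite_measure.emeasure_eq_measure[OF finite_measure_unit_leb] by simp
    moreover have "measure unit_leb E = 1 - measure unit_leb (\<Union>i\<in>K. B i)"
      using finite_measure.finite_measure_compl[OF finite_measure_unit_leb BU] emeasure_unit_leb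
      by (simp add: E_def measure_def)
    ultimately have "\<alpha> < measure unit_leb E" using \<alpha> by simp
    then have \<alpha>E: "\<alpha> < measure lebesgue E" using E by (simp add: measure_restrict_space)
    have "(\<integral>\<^sup>+s\<in>E. (\<Sum>i\<in>K. Phi G \<rho> p i t s) \<partial>lebesgue)
        = (\<integral>\<^sup>+s\<in>E. (\<Sum>i\<in>K. Phi G \<rho> p i t s) \<partial>unit_leb)"
      by (rule nn_integral_lebesgue_unit_leb[OF E(2)])
    also have "\<dots> \<le> (\<integral>\<^sup>+s. ennreal (2 powr p * k) * (\<integral>\<^sup>+j. ennreal (norm (u j (shift_pos t s) - indicator_family K j (shift_pos t s)) powr p
        * \<rho> j (shift_pos t s)) \<partial>count_space (arcs G)) \<partial>unit_leb)"
    proof (rule nn_integral_mono)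
      fix s assume "s \<in> space unit_leb"
      then have s: "s \<in> {0..<1}" by simp
      define W where "W = (\<integral>\<^sup>+j. ennreal (norm (u j (shift_pos t s) - indicator_family K j (shift_pos t s)) powr p
        * \<rho> j (shift_pos t s)) \<partial>count_space (arcs G))"
      have "Phi G \<rho> p i t s \<le> ennreal (2 powr p) * W" if i: "i \<in> K" and sE: "s \<in> E" for i
      proof -
        have iG: "i \<in> arcs G" using i K by blast
        have "1 / 2 \<le> norm (v i s)" using i sE s by (auto simp: E_def B_def not_less)
        then have "1 \<le> (2 * norm (v i s)) powr p"
          using p by (intro ge_one_powr_ge_zero) auto
        then have "ennreal 1 \<le> ennreal (2 powr p) * ennreal (norm (v i s) powr p)"
          by (simp add: powr_mult ennreal_mult'[symmetric] del: ennreal_1)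
        then have "Phi G \<rho> p i t s * 1 \<le> Phi G \<rho> p i t s * (ennreal (2 powr p) * ennreal (norm (v i s) powr p))"
          by (intro mult_left_mono) simp_all
        also have "\<dots> = ennreal (2 powr p) * (Phi G \<rho> p i t s * ennreal (norm (v i s) powr p))"
          by (simp add: mult_ac)
        also have "Phi G \<rho> p i t s * ennreal (norm (v i s) powr p)
           \<le> (\<integral>\<^sup>+j. ennreal (norm (u j (shift_pos t s)) powr p * \<rho> j (shift_pos t s))
               \<partial>count_space (succ_arcs G (shift_n t s) i))"
          unfolding v_def by (rule Phi_left_shift_le[OF iG t s])
        \<comment> \<open>The indicator of K vanishes on these descendants by \<open>away\<close>,
          so u may be replaced by its small difference from the indicator.\<close>
        also have "\<dots> = (\<integral>\<^sup>+j. ennreal (norm (u j (shift_pos t s) - indicator_family K j (shift_pos t s)) powr p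
               * \<rho> j (shift_pos t s)) \<partial>count_space (succ_arcs G (shift_n t s) i))"
          using away[OF i s] by (intro nn_integral_cong) (auto simp: indicator_family_def)
        also have "\<dots> \<le> W"
          unfolding W_def using succ_arcs_subset[OF iG, of "shift_n t s"]
          by (auto simp: nn_integral_count_space_indicator intro!: nn_integral_mono split: split_indicator)
        finally show ?thesis by (simp add: mult_left_mono)
      qed
      \<comment> \<open>Every summand is bounded by the whole of W, at the price of the factor k
        that r already anticipates.\<close>
      then have "(\<Sum>i\<in>K. Phi G \<rho> p i t s) \<le> (\<Sum>i\<in>K. ennreal (2 powr p) * W)" if "s \<in> E"
        using that by (intro sum_mono) auto
      also have "(\<Sum>i\<in>K. ennreal (2 powr p) * W) = ennreal (2 powr p * k) * W"
        by (simp add: k_def ennreal_mult' ennreal_of_nat_eq_real_of_nat mult_ac)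
      finally show "(\<Sum>i\<in>K. Phi G \<rho> p i t s) * indicator E s \<le> ennreal (2 powr p * k) * W"
        by (auto split: split_indicator)
    qed
    also have "\<dots> = ennreal (2 powr p * k) * Lp_mass G \<rho> p (\<lambda>i s. u i s - indicator_family K i s)"
    proof -
      have d: "Lp_meas (\<lambda>i s. u i s - indicator_family K i s)"
        using u indicator_family_Lp[OF K(1,3)] by (intro Lp_meas_diff) (auto simp: Lp_fun_iff)
      have "(\<lambda>s. \<integral>\<^sup>+j. ennreal (norm (u j (shift_pos t s) - indicator_family K j (shift_pos t s)) powr p
        * \<rho> j (shift_pos t s)) \<partial>count_space (arcs G)) \<in> borel_measurable unit_leb"
        using measurable_compose[OF measurable_shift_pos[OF t] Lp_meas_integrand[OF d]]
        by (intro borel_measurable_nn_integral_count_space) auto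
      then show ?thesis unfolding Lp_mass_shift[OF d t] by (rule nn_integral_cmult)
    qed
    also have "\<dots> < ennreal (2 powr p * k) * ennreal r"
      using u1 k by (intro ennreal_mult_strict_left_mono) auto
    also have "\<dots> \<le> ennreal \<epsilon>"
      using r2 r k by (simp add: ennreal_mult'[symmetric] ennreal_leI)
    finally have "(\<integral>\<^sup>+s\<in>E. (\<Sum>i\<in>K. Phi G \<rho> p i t s) \<partial>lebesgue) < ennreal \<epsilon>" .
    then show "t \<in> small_times G \<rho> p K \<epsilon> \<alpha>"
      unfolding small_times_def using t E \<alpha>E
      by (auto intro!: le_less_trans[OF INF_lower])
  qed
qed

end

section \<open>Small times give transitivity\<close>

text \<open>Both sums are suprema of finite sums. A finite value in [0,\<infinity>] thus yields real
  summability, which is needed to pull vectors out of a sum of dual weights.\<close>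

lemma ennreal_infsum:
  fixes a :: "'j \<Rightarrow> real"
  assumes "\<And>j. j \<in> A \<Longrightarrow> 0 \<le> a j" "(\<Sum>\<^sub>\<infinity>j\<in>A. ennreal (a j)) < \<infinity>"
  shows "a summable_on A" "ennreal (infsum a A) = (\<Sum>\<^sub>\<infinity>j\<in>A. ennreal (a j))"
proof -
  have S: "(\<Sum>\<^sub>\<infinity>j\<in>A. ennreal (a j)) = (SUP F\<in>{F. finite F \<and> F \<subseteq> A}. (\<Sum>j\<in>F. ennreal (a j)))"
    by (rule nonneg_infsum_complete) simp
  have e: "(\<Sum>j\<in>F. ennreal (a j)) = ennreal (sum a F)" if "F \<subseteq> A" for F
    using assms(1) that by (auto intro!: sum_ennreal)
  obtain c where c: "(\<Sum>\<^sub>\<infinity>j\<in>A. ennreal (a j)) = ennreal c" "0 \<le> c"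
    using assms(2) by (cases "\<Sum>\<^sub>\<infinity>j\<in>A. ennreal (a j)") auto
  have "sum a F \<le> c" if F: "finite F" "F \<subseteq> A" for F
  proof -
    have "ennreal (sum a F) \<le> ennreal c"
      unfolding c(1)[symmetric] S e[OF F(2), symmetric] using F by (intro SUP_upper) auto
    then show ?thesis using c by simp
  qed
  then show s: "a summable_on A"
    by (intro nonneg_bdd_above_summable_on assms(1)) (auto intro!: bdd_aboveI[of _ c])
  have "ennreal (infsum a A) = (SUP F\<in>{F. finite F \<and> F \<subseteq> A}. ennreal (sum a F))"
    by (rule infsum_nonneg_is_SUPREMUM_ennreal[OF s assms(1)])
  also have "\<dots> = (\<Sum>\<^sub>\<infinity>j\<in>A. ennreal (a j))"
    unfolding S by (intro SUP_cong) (auto simp: e)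
  finally show "ennreal (infsum a A) = (\<Sum>\<^sub>\<infinity>j\<in>A. ennreal (a j))" .
qed

locale admissible_tree = weighted_tree G \<rho> p
  for G :: "('v, 'i) pre_digraph" and \<rho> :: "'i \<Rightarrow> real \<Rightarrow> real" and p :: real +
  assumes rooted: "rooted G" and leafless: "leafless G" and admissible: "admissible G \<rho> p"
begin

section \<open>Dual weights and the exact preimage under a translation\<close>

definition dual_weight :: "'i \<Rightarrow> real \<Rightarrow> real" where
  "dual_weight j s = 1 / \<rho> j s powr (1 / (p - 1))"

definition real_dual_sum :: "'i \<Rightarrow> real \<Rightarrow> real \<Rightarrow> real" where
  "real_dual_sum i t s = enn2real (dual_weight_sum G \<rho> p i t s)"

lemma dual_weight_pos: "j \<in> arcs G \<Longrightarrow> s \<in> {0..<1} \<Longrightarrow> 0 < dual_weight j s"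
  using weight_pos[of j s] by (simp add: dual_weight_def)

text \<open>The exponent identity 1 - p/(p-1) = -1/(p-1). It turns the mass of a multiple of the
  dual weights back into a sum of dual weights.\<close>

lemma dual_weight_powr: "j \<in> arcs G \<Longrightarrow> s \<in> {0..<1} \<Longrightarrow> dual_weight j s powr p * \<rho> j s = dual_weight j s"
proof -
  assume "j \<in> arcs G" "s \<in> {0..<1}"
  then have r: "0 < \<rho> j s" by (rule weight_pos)
  have d: "dual_weight j s = \<rho> j s powr (- 1 / (p - 1))"
    using r by (simp add: dual_weight_def powr_minus_divide)
  have "dual_weight j s powr p * \<rho> j s = \<rho> j s powr (- 1 / (p - 1) * p) * \<rho> j s powr 1"
    unfolding d using r by (simp add: powr_powr)
  also have "\<dots> = \<rho> j s powr (- 1 / (p - 1) * p + 1)" by (rule powr_add[symmetric])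
  also have "- 1 / (p - 1) * p + 1 = - 1 / (p - 1)" using p by (simp add: field_simps)
  finally show ?thesis using d by simp
qed

text \<open>Admissibility gives a finite bound, whereas \<open>epowr\<close> with the positive
  exponent p - 1 would keep an infinite sum infinite.\<close>

lemma dual_weight_sum_finite:
  assumes "i \<in> arcs G" "0 \<le> t" "s \<in> {0..<1}"
  shows "dual_weight_sum G \<rho> p i t s < \<infinity>"
proof -
  obtain M \<omega> where "epowr (dual_weight_sum G \<rho> p i t s) (p - 1) \<le> ennreal (M powr p * exp (p * \<omega> * t) * (1 / \<rho> i s))"
    using admissible assms unfolding admissible_def by blast
  then have "epowr (dual_weight_sum G \<rho> p i t s) (p - 1) < \<infinity>" by (rule le_less_trans) simp
  then show ?thesis using p by (auto simp: epowr_def less_top[symmetric] split: if_splits)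
qed

lemma real_dual_sum:
  assumes i: "i \<in> arcs G" and t: "0 \<le> t" and s: "s \<in> {0..<1}"
  defines "A \<equiv> succ_arcs G (shift_n t s) i"
  shows "(\<lambda>j. dual_weight j (shift_pos t s)) summable_on A"
    "real_dual_sum i t s = (\<Sum>\<^sub>\<infinity>j\<in>A. dual_weight j (shift_pos t s))"
    "0 < real_dual_sum i t s"
    "dual_weight_sum G \<rho> p i t s = ennreal (real_dual_sum i t s)"
proof -
  have A: "A \<subseteq> arcs G" "A \<noteq> {}"
    unfolding A_def using succ_arcs_subset[OF i] succ_arcs_nonempty[OF tree leafless i] by auto
  have pos: "0 < dual_weight j (shift_pos t s)" if "j \<in> A" for j
    using dual_weight_pos[OF _ shift_pos_in[OF t s]] A that by blast
  have D: "dual_weight_sum G \<rho> p i t s = (\<Sum>\<^sub>\<infinity>j\<in>A. ennreal (dual_weight j (shift_pos t s)))"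
    by (simp add: dual_weight_sum_def dual_weight_def A_def)
  note fin = dual_weight_sum_finite[OF i t s, unfolded D]
  show sm: "(\<lambda>j. dual_weight j (shift_pos t s)) summable_on A"
    using ennreal_infsum(1)[OF _ fin] pos by (simp add: less_imp_le)
  have e: "ennreal (\<Sum>\<^sub>\<infinity>j\<in>A. dual_weight j (shift_pos t s)) = dual_weight_sum G \<rho> p i t s"
    unfolding D using ennreal_infsum(2)[OF _ fin] pos by (simp add: less_imp_le)
  have nn: "0 \<le> (\<Sum>\<^sub>\<infinity>j\<in>A. dual_weight j (shift_pos t s))"
    using pos by (intro infsum_nonneg) (simp add: less_imp_le)
  show r: "real_dual_sum i t s = (\<Sum>\<^sub>\<infinity>j\<in>A. dual_weight j (shift_pos t s))"
    unfolding real_dual_sum_def e[symmetric] using nn by simp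
  show "dual_weight_sum G \<rho> p i t s = ennreal (real_dual_sum i t s)" using e r by simp
  obtain j where j: "j \<in> A" using A by blast
  have "dual_weight j (shift_pos t s) \<le> (\<Sum>\<^sub>\<infinity>j\<in>A. dual_weight j (shift_pos t s))"
    using finite_sum_le_infsum[OF sm, of "{j}"] j pos by (simp add: less_imp_le)
  then show "0 < real_dual_sum i t s" using pos[OF j] r by simp
qed

text \<open>The index set depends on s through \<open>shift_n\<close>. Extension by zero to the
  fixed countable set of arcs makes measurability in s accessible and lets the sum be matched with a
  mass.\<close>

lemma dual_weight_sum_arcs:
  assumes i: "i \<in> arcs G"
  shows "dual_weight_sum G \<rho> p i t s
     = (\<integral>\<^sup>+j. (if j \<in> succ_arcs G (shift_n t s) i then ennreal (dual_weight j (shift_pos t s)) else 0)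
      \<partial>count_space (arcs G))"
proof -
  have "countable (succ_arcs G (shift_n t s) i)"
    using succ_arcs_subset[OF i] countable_arcs by (rule countable_subset)
  then have "dual_weight_sum G \<rho> p i t s
     = (\<integral>\<^sup>+j. ennreal (dual_weight j (shift_pos t s)) \<partial>count_space (succ_arcs G (shift_n t s) i))"
    by (simp add: dual_weight_sum_def dual_weight_def infsum_eq_nn_integral_count_space)
  also have "\<dots> = (\<integral>\<^sup>+j. (if j \<in> succ_arcs G (shift_n t s) i then ennreal (dual_weight j (shift_pos t s)) else 0)
    \<partial>count_space (succ_arcs G (shift_n t s) i))"
    by (intro nn_integral_cong) simp
  also have "\<dots> = (\<integral>\<^sup>+j. (if j \<in> succ_arcs G (shift_n t s) i then ennreal (dual_weight j (shift_pos t s)) else 0)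
    \<partial>count_space (arcs G))"
    using succ_arcs_subset[OF i] by (intro nn_integral_count_space_eq) auto
  finally show ?thesis .
qed

lemma real_dual_sum_measurable:
  assumes i: "i \<in> arcs G" and t: "0 \<le> t"
  shows "real_dual_sum i t \<in> borel_measurable unit_leb"
proof -
  have n [measurable]: "shift_n t \<in> measurable unit_leb (count_space UNIV)" by (rule measurable_shift_n)
  have "(\<lambda>s. \<integral>\<^sup>+j. (if j \<in> succ_arcs G (shift_n t s) i then ennreal (dual_weight j (shift_pos t s)) else 0)
      \<partial>count_space (arcs G)) \<in> borel_measurable unit_leb"
  proof (rule borel_measurable_nn_integral_count_space[OF countable_arcs])
    fix j assume j: "j \<in> arcs G"
    have [measurable]: "\<rho> j \<in> borel_measurable unit_leb" by (rule weight_measurable[OF j])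
    have [measurable]: "shift_pos t \<in> measurable unit_leb unit_leb" by (rule measurable_shift_pos[OF t])
    show "(\<lambda>s. if j \<in> succ_arcs G (shift_n t s) i then ennreal (dual_weight j (shift_pos t s)) else 0)
        \<in> borel_measurable unit_leb"
      unfolding dual_weight_def by measurable
  qed
  then show ?thesis unfolding real_dual_sum_def dual_weight_sum_arcs[OF i] by simp
qed

text \<open>
  The perturbation \<open>h\<close> spreads the values \<open>g i s\<close> over the descendants of \<open>i\<close> proportionally to
  the dual weights, which is the case of equality in Hoelder's inequality.
\<close>

lemma left_shift_preimage:
  fixes g :: "'i \<Rightarrow> real \<Rightarrow> 'k::{real_normed_field, euclidean_space}"
  assumes t: "0 \<le> t" and K: "finite K" "K \<subseteq> arcs G"
    and g: "Lp_meas g" "\<And>i s. norm (g i s) \<le> C" "\<And>i s. i \<notin> K \<Longrightarrow> g i s = 0"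
    and E: "E \<in> sets unit_leb"
  obtains h where "Lp_meas h"
    "\<And>i s. i \<in> arcs G \<Longrightarrow> s \<in> {0..<1} \<Longrightarrow> left_shift_fun G t h i s = indicator E s *\<^sub>R g i s"
    "Lp_mass G \<rho> p h \<le> ennreal (C powr p) * (\<integral>\<^sup>+s\<in>E. (\<Sum>i\<in>K. Phi G \<rho> p i t s) \<partial>unit_leb)"
proof -
  \<comment> \<open>The perturbation must be given as a function of the coordinate on the
    descendant, while g is read at s; this rotation recovers s.\<close>
  define unshift where "unshift = shift_pos (of_int \<lceil>t\<rceil> - t)"
  have tb: "0 \<le> of_int \<lceil>t\<rceil> - t" by simp
  have unshift: "unshift (shift_pos t s) = s" if "s \<in> {0..<1}" for s
    using shift_pos_inverse[OF t that] by (simp add: unshift_def)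
  define w where "w i j s = (if j \<in> succ_arcs G (shift_n t s) i \<and> s \<in> E
      then (dual_weight j (shift_pos t s) / real_dual_sum i t s) *\<^sub>R g i s else 0)" for i j s
  define h where "h j r = (\<Sum>i\<in>K. w i j (unshift r))" for j r
  have hs: "h j (shift_pos t s) = (\<Sum>i\<in>K. w i j s)" if "s \<in> {0..<1}" for j s
    using unshift[OF that] by (simp add: h_def)
  have w_single: "(\<Sum>i'\<in>K. w i' j s) = w i j s"
    if "i \<in> arcs G" "j \<in> succ_arcs G (shift_n t s) i" for i j s
  proof -
    \<comment> \<open>An arc j descends from only one edge in the given generation, so at most one
      summand of h survives.\<close>
    have z: "w i' j s = 0" if "i' \<in> K" "i' \<noteq> i" for i'
      using succ_arcs_disjoint[OF tree \<open>i \<in> arcs G\<close> _ \<open>j \<in> _\<close>] that K by (auto simp: w_def)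
    show ?thesis
    proof (cases "i \<in> K")
      case True
      then have "(\<Sum>i'\<in>K. w i' j s) = w i j s + (\<Sum>i'\<in>K - {i}. w i' j s)"
        using K by (simp add: sum.remove)
      then show ?thesis using z by simp
    next
      case False
      then have "w i' j s = 0" if "i' \<in> K" for i' using z that by auto
      moreover have "w i j s = 0" using False g(3) by (simp add: w_def)
      ultimately show ?thesis by simp
    qed
  qed
  show thesis
  proof
    show hm: "Lp_meas h"
      unfolding Lp_meas_def
    proof
      fix j assume j: "j \<in> arcs G"
      have [measurable]: "unshift \<in> measurable unit_leb unit_leb"
        unfolding unshift_def by (rule measurable_shift_pos[OF tb])
      have [measurable]: "shift_pos t \<in> measurable unit_leb unit_leb" by (rule measurable_shift_pos[OF t])
      have [measurable]: "shift_n t \<in> measurable unit_leb (count_space UNIV)" by (rule measurable_shift_n)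
      have [measurable]: "\<rho> j \<in> borel_measurable unit_leb" by (rule weight_measurable[OF j])
      have [measurable]: "E \<in> sets unit_leb" by (rule E)
      have "(\<lambda>s. w i j s) \<in> borel_measurable unit_leb" if "i \<in> K" for i
      proof -
        have i: "i \<in> arcs G" using that K by blast
        have [measurable]: "real_dual_sum i t \<in> borel_measurable unit_leb"
          by (rule real_dual_sum_measurable[OF i t])
        have [measurable]: "g i \<in> borel_measurable unit_leb" by (rule Lp_measD[OF g(1) i])
        show ?thesis unfolding w_def dual_weight_def by measurable
      qed
      then have "(\<lambda>r. w i j (unshift r)) \<in> borel_measurable unit_leb" if "i \<in> K" for i
        using measurable_compose[OF \<open>unshift \<in> _\<close>] that by blast
      then show "h j \<in> borel_measurable unit_leb"
        unfolding h_def by (intro borel_measurable_sum)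
    qed
    show "left_shift_fun G t h i s = indicator E s *\<^sub>R g i s" if i: "i \<in> arcs G" and s: "s \<in> {0..<1}" for i s
    proof -
      define A where "A = succ_arcs G (shift_n t s) i"
      note d = real_dual_sum[OF i t s]
      have "left_shift_fun G t h i s = (\<Sum>\<^sub>\<infinity>j\<in>A. h j (shift_pos t s))"
        by (simp add: left_shift_fun_def A_def)
      also have "\<dots> = (\<Sum>\<^sub>\<infinity>j\<in>A. dual_weight j (shift_pos t s) *\<^sub>R ((indicator E s / real_dual_sum i t s) *\<^sub>R g i s))"
      proof (rule infsum_cong)
        fix j assume "j \<in> A"
        then show "h j (shift_pos t s) = dual_weight j (shift_pos t s) *\<^sub>R ((indicator E s / real_dual_sum i t s) *\<^sub>R g i s)"
          using w_single[OF i] by (auto simp: hs[OF s] A_def w_def indicator_def)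
      qed
      also have "\<dots> = (\<Sum>\<^sub>\<infinity>j\<in>A. dual_weight j (shift_pos t s)) *\<^sub>R ((indicator E s / real_dual_sum i t s) *\<^sub>R g i s)"
        using d(1) unfolding A_def by (intro infsum_scaleR_left) simp
      also have "(\<Sum>\<^sub>\<infinity>j\<in>A. dual_weight j (shift_pos t s)) = real_dual_sum i t s"
        using d(2) by (simp add: A_def)
      finally show ?thesis using d(3) by simp
    qed
    show "Lp_mass G \<rho> p h \<le> ennreal (C powr p) * (\<integral>\<^sup>+s\<in>E. (\<Sum>i\<in>K. Phi G \<rho> p i t s) \<partial>unit_leb)"
    proof -
      define P where "P s = (\<Sum>i\<in>K. ennreal (real_dual_sum i t s powr (1 - p))) * indicator E s" for s
      have "(\<integral>\<^sup>+j. ennreal (norm (h j (shift_pos t s)) powr p * \<rho> j (shift_pos t s)) \<partial>count_space (arcs G))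
          \<le> ennreal (C powr p) * P s" if s: "s \<in> {0..<1}" for s
      proof -
        \<comment> \<open>With D the dual sum, \<open>c i\<close> carries
          \<open>D powr (-p)\<close>. One power of the dual weight remains by
          \<open>dual_weight_powr\<close>; summed over the descendants it supplies a factor D, which
          gives \<open>D powr (1 - p)\<close>, the value of \<open>Phi\<close>.\<close>
        define c where "c i = ennreal (C powr p * real_dual_sum i t s powr (- p)) * indicator E s" for i
        define a where "a i j = (if j \<in> succ_arcs G (shift_n t s) i then ennreal (dual_weight j (shift_pos t s)) else 0)" for i j
        have d: "0 < real_dual_sum i t s" if "i \<in> K" for i
          using real_dual_sum(3)[OF _ t s] K that by blast
        have "ennreal (norm (h j (shift_pos t s)) powr p * \<rho> j (shift_pos t s)) \<le> (\<Sum>i\<in>K. c i * a i j)"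
          if j: "j \<in> arcs G" for j
        proof (cases "\<exists>i\<in>K. j \<in> succ_arcs G (shift_n t s) i \<and> s \<in> E")
          case True
          then obtain i where i: "i \<in> K" "j \<in> succ_arcs G (shift_n t s) i" "s \<in> E" by blast
          have r: "0 < \<rho> j (shift_pos t s)" "0 < dual_weight j (shift_pos t s)"
            using weight_pos[OF j] dual_weight_pos[OF j] shift_pos_in[OF t s] by auto
          have "norm (h j (shift_pos t s)) = dual_weight j (shift_pos t s) / real_dual_sum i t s * norm (g i s)"
            using w_single[of i j s] i K d[OF i(1)] r by (auto simp: hs[OF s] w_def)
          then have "norm (h j (shift_pos t s)) powr p * \<rho> j (shift_pos t s)
            = (dual_weight j (shift_pos t s) / real_dual_sum i t s * norm (g i s)) powr p * \<rho> j (shift_pos t s)"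
            by (simp only:)
          also have "\<dots> = real_dual_sum i t s powr (- p) * norm (g i s) powr p * (dual_weight j (shift_pos t s) powr p * \<rho> j (shift_pos t s))"
            by (simp add: powr_mult powr_divide powr_minus_divide)
          also have "\<dots> = real_dual_sum i t s powr (- p) * norm (g i s) powr p * dual_weight j (shift_pos t s)"
            using dual_weight_powr[OF j shift_pos_in[OF t s]] by simp
          also have "\<dots> \<le> real_dual_sum i t s powr (- p) * C powr p * dual_weight j (shift_pos t s)"
            using r p g(2) by (intro mult_right_mono mult_left_mono powr_mono2) auto
          finally have "ennreal (norm (h j (shift_pos t s)) powr p * \<rho> j (shift_pos t s)) \<le> c i * a i j"
            using i r by (simp add: c_def a_def ennreal_mult'[symmetric] ennreal_leI mult.commute)
          also have "\<dots> \<le> (\<Sum>i\<in>K. c i * a i j)"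
            using i K by (intro member_le_sum) auto
          finally show ?thesis .
        next
          case False
          then have "w i j s = 0" if "i \<in> K" for i using that by (auto simp: w_def)
          then have "h j (shift_pos t s) = 0" by (simp add: hs[OF s])
          then show ?thesis by simp
        qed
        then have "(\<integral>\<^sup>+j. ennreal (norm (h j (shift_pos t s)) powr p * \<rho> j (shift_pos t s)) \<partial>count_space (arcs G))
          \<le> (\<integral>\<^sup>+j. (\<Sum>i\<in>K. c i * a i j) \<partial>count_space (arcs G))"
          by (intro nn_integral_mono) simp
        also have "\<dots> = (\<Sum>i\<in>K. c i * (\<integral>\<^sup>+j. a i j \<partial>count_space (arcs G)))"
          by (simp add: nn_integral_sum nn_integral_cmult)
        also have "\<dots> = (\<Sum>i\<in>K. ennreal (C powr p) * ennreal (real_dual_sum i t s powr (1 - p)) * indicator E s)"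
        proof (rule sum.cong)
          fix i assume i: "i \<in> K"
          then have iG: "i \<in> arcs G" using K by blast
          have "(\<integral>\<^sup>+j. a i j \<partial>count_space (arcs G)) = ennreal (real_dual_sum i t s)"
            unfolding a_def dual_weight_sum_arcs[OF iG, symmetric] by (rule real_dual_sum(4)[OF iG t s])
          moreover have "real_dual_sum i t s powr (- p) * real_dual_sum i t s = real_dual_sum i t s powr (1 - p)"
            using d[OF i] by (simp add: powr_diff powr_minus field_simps)
          ultimately show "c i * (\<integral>\<^sup>+j. a i j \<partial>count_space (arcs G))
            = ennreal (C powr p) * ennreal (real_dual_sum i t s powr (1 - p)) * indicator E s"
            using d[OF i] by (auto simp: c_def ennreal_mult'[symmetric] mult.assoc split: split_indicator)
        qed simp
        also have "\<dots> = ennreal (C powr p) * P s"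
          by (simp add: P_def sum_distrib_left sum_distrib_right mult.assoc del: sum_ennreal)
        finally show ?thesis .
      qed
      then have "Lp_mass G \<rho> p h \<le> (\<integral>\<^sup>+s. ennreal (C powr p) * P s \<partial>unit_leb)"
        unfolding Lp_mass_shift[OF hm t] by (intro nn_integral_mono) simp
      also have "\<dots> = ennreal (C powr p) * (\<integral>\<^sup>+s. P s \<partial>unit_leb)"
      proof (rule nn_integral_cmult)
        have [measurable]: "E \<in> sets unit_leb" by (rule E)
        have "(\<lambda>s. ennreal (real_dual_sum i t s powr (1 - p))) \<in> borel_measurable unit_leb" if "i \<in> K" for i
        proof -
          have "i \<in> arcs G" using that K by blast
          note [measurable] = real_dual_sum_measurable[OF this t]
          show ?thesis by measurable
        qed
        then have [measurable]: "(\<lambda>s. \<Sum>i\<in>K. ennreal (real_dual_sum i t s powr (1 - p))) \<in> borel_measurable unit_leb"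
          by (intro borel_measurable_sum)
        show "P \<in> borel_measurable unit_leb" unfolding P_def by measurable
      qed
      also have "(\<integral>\<^sup>+s. P s \<partial>unit_leb) = (\<integral>\<^sup>+s\<in>E. (\<Sum>i\<in>K. Phi G \<rho> p i t s) \<partial>unit_leb)"
      proof (rule nn_integral_cong)
        fix s assume "s \<in> space unit_leb"
        then have s: "s \<in> {0..<1}" by simp
        have "Phi G \<rho> p i t s = ennreal (real_dual_sum i t s powr (1 - p))" if "i \<in> K" for i
        proof -
          have "i \<in> arcs G" using that K by blast
          from real_dual_sum(3,4)[OF this t s] show ?thesis using p by (simp add: Phi_def epowr_def)
        qed
        then show "P s = (\<Sum>i\<in>K. Phi G \<rho> p i t s) * indicator E s" by (simp add: P_def)
      qed
      finally show ?thesis .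
    qed
  qed
qed

end

section \<open>Open sets and the two main implications\<close>

context admissible_tree
begin

lemma arcs_nonempty: "arcs G \<noteq> {}"
proof -
  obtain v where "v \<in> verts G" using rooted by (auto simp: rooted_def is_root_def)
  then have "out_arcs G v \<noteq> {}" using leafless by (auto simp: leafless_def is_leaf_def)
  then show ?thesis by (auto simp: out_arcs_def)
qed

lemma openin_Lp_topology_subset:
  "openin (Lp_topology G \<rho> p) U \<Longrightarrow> U \<subseteq> Lp_space G \<rho> p"
  unfolding Lp_topology_def
  using Metric_space.openin_mtopology[OF Metric_space_Lp] by blast

lemma shift_n_ge: "real N \<le> t \<Longrightarrow> 0 \<le> s \<Longrightarrow> N \<le> shift_n t s"
  unfolding shift_n_def by (simp add: le_nat_floor)

lemma open_contains_bounded_finite_support: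
  fixes U :: "('i \<Rightarrow> real \<Rightarrow> 'k::{real_normed_field, euclidean_space}) set set"
  assumes U: "openin (Lp_topology G \<rho> p) U" "U \<noteq> {}"
  obtains K C f r where "finite K" "K \<noteq> {}" "K \<subseteq> arcs G" "0 < C" "f \<in> Lp_fun G \<rho> p"
    "\<And>i s. norm (f i s) \<le> C" "\<And>i s. i \<notin> K \<Longrightarrow> f i s = 0" "0 < r"
    "\<And>g. g \<in> Lp_fun G \<rho> p \<Longrightarrow> Lp_mass G \<rho> p (\<lambda>i s. g i s - f i s) < ennreal r
    \<Longrightarrow> Lp_rel G \<rho> p `` {g} \<in> U"
proof -
  obtain X where X: "X \<in> U" "X \<in> Lp_space G \<rho> p" using U openin_Lp_topology_subset by blast
  obtain f0 where f0: "f0 \<in> X" "f0 \<in> Lp_fun G \<rho> p"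
    using Lp_spaceD(1)[OF X(2)] Lp_spaceD(2)[OF X(2) Lp_spaceD(1)[OF X(2)]] by blast
  obtain r0 where r0: "0 < r0" "\<And>g. g \<in> Lp_fun G \<rho> p \<Longrightarrow> Lp_mass G \<rho> p (\<lambda>i s. g i s - f0 i s) < ennreal r0
    \<Longrightarrow> Lp_rel G \<rho> p `` {g} \<in> U"
    using openin_Lp_topology_rep[OF U(1) X(1) f0(1)] by blast
  obtain K C f where f: "finite K" "K \<subseteq> arcs G" "0 < C" "f \<in> Lp_fun G \<rho> p"
    "\<And>i s. norm (f i s) \<le> C" "\<And>i s. i \<notin> K \<Longrightarrow> f i s = 0"
    "Lp_mass G \<rho> p (\<lambda>i s. f i s - f0 i s) < ennreal r0"
    using Lp_approx[OF f0(2) r0(1)] by blast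
  \<comment> \<open>Since the class of the truncated f lies in U, the open set contains a second
    ball, now centred at f itself.\<close>
  obtain r where r: "0 < r" "\<And>g. g \<in> Lp_fun G \<rho> p \<Longrightarrow> Lp_mass G \<rho> p (\<lambda>i s. g i s - f i s) < ennreal r
    \<Longrightarrow> Lp_rel G \<rho> p `` {g} \<in> U"
    using openin_Lp_topology_rep[OF U(1) r0(2)[OF f(4) f(7)] Lp_class(2)[OF f(4)]] by blast
  \<comment> \<open>Enlarging the support set leaves f unchanged and makes K nonempty, as the
    criterion on small times demands.\<close>
  obtain i0 where "i0 \<in> arcs G" using arcs_nonempty by blast
  then show thesis using f r by (intro that[of "insert i0 K" C f r]) auto
qed

text \<open>The parameters separate: K and \<alpha> come from the target g in V, \<epsilon> from the
  radius around f in U and the bound on g, and R from the support of f alone.\<close>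

lemma small_times_subset_return_set:
  fixes U V :: "('i \<Rightarrow> real \<Rightarrow> 'k::{real_normed_field, euclidean_space}) set set"
  assumes U: "openin (Lp_topology G \<rho> p) U" "U \<noteq> {}" and V: "openin (Lp_topology G \<rho> p) V" "V \<noteq> {}"
  obtains K \<epsilon> \<alpha> R where "finite K" "K \<noteq> {}" "K \<subseteq> arcs G" "0 < \<epsilon>" "0 < \<alpha>" "\<alpha> < 1" "0 < R"
    "small_times G \<rho> p K \<epsilon> \<alpha> \<inter> {R<..} \<subseteq> return_set (left_shift G \<rho> p) U V"
proof -
  obtain L C1 f r where f: "finite L" "L \<subseteq> arcs G" "f \<in> Lp_fun G \<rho> p"
    "\<And>i s. i \<notin> L \<Longrightarrow> f i s = 0" and r: "0 < r"
    "\<And>g. g \<in> Lp_fun G \<rho> p \<Longrightarrow> Lp_mass G \<rho> p (\<lambda>i s. g i s - f i s) < ennreal r \<Longrightarrow> Lp_rel G \<rho> p `` {g} \<in> U"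
    by (rule open_contains_bounded_finite_support[OF U]) blast
  obtain K C g q where K: "finite K" "K \<noteq> {}" "K \<subseteq> arcs G" and g: "0 < C" "g \<in> Lp_fun G \<rho> p"
    "\<And>i s. norm (g i s) \<le> C" "\<And>i s. i \<notin> K \<Longrightarrow> g i s = 0" and q: "0 < q"
    "\<And>u. u \<in> Lp_fun G \<rho> p \<Longrightarrow> Lp_mass G \<rho> p (\<lambda>i s. u i s - g i s) < ennreal q \<Longrightarrow> Lp_rel G \<rho> p `` {u} \<in> V"
    by (rule open_contains_bounded_finite_support[OF V]) blast
  have gm: "Lp_meas g" using g by (simp add: Lp_fun_iff)
  obtain N where N: "\<And>n i. n \<ge> N \<Longrightarrow> i \<in> arcs G \<Longrightarrow> succ_arcs G n i \<inter> L = {}"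
    using succ_arcs_avoid_finite[OF tree rooted f(1,2)] by blast
  define k where "k = real (card K)"
  have k: "0 < k" using K by (simp add: k_def card_gt_0_iff)
  \<comment> \<open>Restricting g to E costs at most C^p * \<eta> on each of the k edges, in total
    half of q.\<close>
  define \<eta> where "\<eta> = q / (2 * C powr p * k)"
  have \<eta>: "0 < \<eta>" using q g k by (simp add: \<eta>_def)
  have "\<exists>\<delta>>0. \<forall>B\<in>sets unit_leb. emeasure unit_leb B \<le> ennreal \<delta> \<longrightarrow> (\<integral>\<^sup>+s\<in>B. ennreal (\<rho> i s) \<partial>unit_leb) \<le> ennreal \<eta>"
    if "i \<in> K" for i
  proof -
    have i: "i \<in> arcs G" using that K by blast
    have "(\<lambda>s. ennreal (\<rho> i s)) \<in> borel_measurable unit_leb" using weight_measurable[OF i] by simp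
    from nn_integral_small_on_small_sets[OF this weight_nn_integral_finite[OF i] \<eta>]
    obtain \<delta> :: real where "0 < \<delta>" "\<And>B. B \<in> sets unit_leb \<Longrightarrow> emeasure unit_leb B \<le> ennreal \<delta> \<Longrightarrow>
        (\<integral>\<^sup>+s\<in>B. ennreal (\<rho> i s) \<partial>unit_leb) \<le> ennreal \<eta>"
      by blast
    then show ?thesis by blast
  qed
  then obtain \<delta> where \<delta>: "\<And>i. i \<in> K \<Longrightarrow> 0 < \<delta> i"
    "\<And>i B. i \<in> K \<Longrightarrow> B \<in> sets unit_leb \<Longrightarrow> emeasure unit_leb B \<le> ennreal (\<delta> i)
       \<Longrightarrow> (\<integral>\<^sup>+s\<in>B. ennreal (\<rho> i s) \<partial>unit_leb) \<le> ennreal \<eta>"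
    by metis
  \<comment> \<open>The complement of E has measure at most d, small enough for every edge of K. The
    cap 1/2 keeps \<alpha> = 1 - d positive.\<close>
  define d where "d = min (1 / 2) (Min (\<delta> ` K))"
  have d: "0 < d" "d \<le> 1 / 2" "\<And>i. i \<in> K \<Longrightarrow> d \<le> \<delta> i"
    using \<delta>(1) K by (auto simp: d_def min.coboundedI2)
  \<comment> \<open>The perturbation has mass at most C^p * \<epsilon>, which is half of r.\<close>
  define \<epsilon> where "\<epsilon> = r / (2 * C powr p)"
  have \<epsilon>: "0 < \<epsilon>" using r g by (simp add: \<epsilon>_def)
  show thesis
  \<comment> \<open>Adding 1 to N guarantees R > 0, which finite invariance requires.\<close>
  proof (rule that[of K \<epsilon> "1 - d" "real N + 1"])
    show "small_times G \<rho> p K \<epsilon> (1 - d) \<inter> {real N + 1<..} \<subseteq> return_set (left_shift G \<rho> p) U V"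
    proof
      fix t assume "t \<in> small_times G \<rho> p K \<epsilon> (1 - d) \<inter> {real N + 1<..}"
      then have t: "0 \<le> t" "real N \<le> t"
        and "(INF E \<in> {E \<in> sets lebesgue. E \<subseteq> {0..<1} \<and> 1 - d < measure lebesgue E}.
            \<integral>\<^sup>+s\<in>E. (\<Sum>i\<in>K. Phi G \<rho> p i t s) \<partial>lebesgue) < ennreal \<epsilon>"
        by (auto simp: small_times_def)
      then obtain E where E: "E \<in> sets lebesgue" "E \<subseteq> {0..<1}" "1 - d < measure lebesgue E"
        and "(\<integral>\<^sup>+s\<in>E. (\<Sum>i\<in>K. Phi G \<rho> p i t s) \<partial>lebesgue) < ennreal \<epsilon>"
        unfolding INF_less_iff by blast
      then have EPhi: "(\<integral>\<^sup>+s\<in>E. (\<Sum>i\<in>K. Phi G \<rho> p i t s) \<partial>unit_leb) < ennreal \<epsilon>"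
        by (simp add: nn_integral_lebesgue_unit_leb)
      have Em: "E \<in> sets unit_leb" using E by (simp add: sets_restrict_space_iff)
      define B where "B = {0..<1} - E"
      have Bm: "B \<in> sets unit_leb"
        unfolding B_def using sets.compl_sets[OF Em] by simp
      have "emeasure unit_leb B \<le> ennreal d"
      proof -
        have "measure unit_leb B = 1 - measure unit_leb E"
          using finite_measure.finite_measure_compl[OF finite_measure_unit_leb Em] emeasure_unit_leb
          by (simp add: B_def measure_def)
        also have "measure unit_leb E = measure lebesgue E" using E by (simp add: measure_restrict_space)
        finally show ?thesis
          using E(3) by (simp add: finite_measure.emeasure_eq_measure[OF finite_measure_unit_leb] ennreal_leI)
      qed
      then have B\<rho>: "(\<integral>\<^sup>+s\<in>B. ennreal (\<rho> i s) \<partial>unit_leb) \<le> ennreal \<eta>" if "i \<in> K" for i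
        using \<delta>(2)[OF that Bm] d(3)[OF that] by (meson ennreal_leI order_trans)
      define gE where "gE i s = indicator E s *\<^sub>R g i s" for i s
      have gEm: "Lp_meas gE"
        unfolding Lp_meas_def gE_def
        using Em Lp_measD[OF gm] by (auto intro!: borel_measurable_scaleR)
      have "Lp_mass G \<rho> p gE \<le> Lp_mass G \<rho> p g"
        by (rule Lp_mass_mono) (auto simp: gE_def split: split_indicator)
      then have gE: "gE \<in> Lp_fun G \<rho> p"
        using g(2) gEm by (auto simp: Lp_fun_iff intro: le_less_trans)
      have gEg: "Lp_mass G \<rho> p (\<lambda>i s. gE i s - g i s) < ennreal q"
      proof -
        have "Lp_mass G \<rho> p (\<lambda>i s. gE i s - g i s)
          = (\<integral>\<^sup>+i. \<integral>\<^sup>+s. ennreal (norm (gE i s - g i s) powr p * \<rho> i s) \<partial>unit_leb \<partial>count_space K)"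
          unfolding Lp_mass_nn_integral using K(3) g(4)
          by (intro nn_integral_count_space_eq) (auto simp: gE_def)
        also have "\<dots> = (\<Sum>i\<in>K. \<integral>\<^sup>+s. ennreal (norm (gE i s - g i s) powr p * \<rho> i s) \<partial>unit_leb)"
          using K by (simp add: nn_integral_count_space_finite)
        also have "\<dots> \<le> (\<Sum>i\<in>K. ennreal (C powr p) * ennreal \<eta>)"
        proof (rule sum_mono)
          fix i assume i: "i \<in> K"
          then have iG: "i \<in> arcs G" using K by blast
          have "(\<integral>\<^sup>+s. ennreal (norm (gE i s - g i s) powr p * \<rho> i s) \<partial>unit_leb)
            \<le> (\<integral>\<^sup>+s. ennreal (C powr p) * (ennreal (\<rho> i s) * indicator B s) \<partial>unit_leb)"
          proof (rule nn_integral_mono)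
            fix s assume s: "s \<in> space unit_leb"
            have r0: "0 < \<rho> i s" using weight_pos[OF iG] s by simp
            show "ennreal (norm (gE i s - g i s) powr p * \<rho> i s) \<le> ennreal (C powr p) * (ennreal (\<rho> i s) * indicator B s)"
            proof (cases "s \<in> E")
              case False
              have "norm (g i s) powr p * \<rho> i s \<le> C powr p * \<rho> i s"
                using r0 p g(3) by (intro mult_right_mono powr_mono2) auto
              then show ?thesis
                using False s r0 by (simp add: gE_def B_def ennreal_mult'[symmetric] ennreal_leI)
            qed (simp add: gE_def)
          qed
          also have "\<dots> = ennreal (C powr p) * (\<integral>\<^sup>+s\<in>B. ennreal (\<rho> i s) \<partial>unit_leb)"
          proof (rule nn_integral_cmult)
            note [measurable] = weight_measurable[OF iG] Bm
            show "(\<lambda>s. ennreal (\<rho> i s) * indicator B s) \<in> borel_measurable unit_leb" by measurable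
          qed
          also have "\<dots> \<le> ennreal (C powr p) * ennreal \<eta>"
            by (intro mult_left_mono B\<rho>[OF i]) simp
          finally show "(\<integral>\<^sup>+s. ennreal (norm (gE i s - g i s) powr p * \<rho> i s) \<partial>unit_leb) \<le> ennreal (C powr p) * ennreal \<eta>" .
        qed
        also have "\<dots> = ennreal (k * (C powr p * \<eta>))"
          using \<eta> by (simp add: k_def ennreal_mult' ennreal_of_nat_eq_real_of_nat)
        also have "k * (C powr p * \<eta>) = q / 2" using k g(1) by (simp add: \<eta>_def)
        finally show ?thesis using q(1) by (simp add: le_less_trans ennreal_lessI)
      qed
      obtain h where h: "Lp_meas h"
        "\<And>i s. i \<in> arcs G \<Longrightarrow> s \<in> {0..<1} \<Longrightarrow> left_shift_fun G t h i s = indicator E s *\<^sub>R g i s"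
        "Lp_mass G \<rho> p h \<le> ennreal (C powr p) * (\<integral>\<^sup>+s\<in>E. (\<Sum>i\<in>K. Phi G \<rho> p i t s) \<partial>unit_leb)"
        using left_shift_preimage[OF t(1) K(1,3) gm g(3,4) Em] by blast
      have hr: "Lp_mass G \<rho> p h < ennreal r"
      proof -
        have "Lp_mass G \<rho> p h \<le> ennreal (C powr p) * ennreal \<epsilon>"
          using h(3) by (rule order_trans) (intro mult_left_mono less_imp_le[OF EPhi], simp)
        also have "\<dots> = ennreal (r / 2)" using g(1) \<epsilon> by (simp add: ennreal_mult'[symmetric] \<epsilon>_def)
        also have "\<dots> < ennreal r" using r(1) by (simp add: ennreal_lessI)
        finally show ?thesis .
      qed
      have hL: "h \<in> Lp_fun G \<rho> p" using h(1) hr by (auto simp: Lp_fun_iff intro: less_trans)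
      define u where "u i s = f i s + h i s" for i s
      have u: "u \<in> Lp_fun G \<rho> p" unfolding u_def[abs_def] by (rule Lp_fun_add(1)[OF f(3) hL])
      have uU: "Lp_rel G \<rho> p `` {u} \<in> U"
        using hr by (intro r(2)[OF u]) (simp add: u_def)
      have Tu: "left_shift_fun G t u i s = gE i s" if i: "i \<in> arcs G" and s: "s \<in> {0..<1}" for i s
      proof -
        have "succ_arcs G (shift_n t s) i \<inter> L = {}"
          using N[OF shift_n_ge[OF t(2)] i] s by simp
        then have "left_shift_fun G t u i s = left_shift_fun G t h i s"
          unfolding left_shift_fun_def using f(4) by (intro infsum_cong) (auto simp: u_def)
        then show ?thesis using h(2)[OF i s] by (simp add: gE_def)
      qed
      \<comment> \<open>The pointwise formula for the image identifies it with \<open>gE\<close>, so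
        membership is inherited and the class of the image can be computed.\<close>
      have TuL: "left_shift_fun G t u \<in> Lp_fun G \<rho> p"
      proof -
        have "Lp_mass G \<rho> p (left_shift_fun G t u) = Lp_mass G \<rho> p gE"
          by (rule Lp_mass_cong_AE) (auto intro!: AE_I2 simp: Tu)
        moreover have "left_shift_fun G t u i \<in> borel_measurable unit_leb" if "i \<in> arcs G" for i
          using Lp_measD[OF gEm that] Tu[OF that] by (subst measurable_cong[of _ _ "gE i"]) auto
        ultimately show ?thesis using gE by (simp add: Lp_fun_iff Lp_meas_def)
      qed
      have "Lp_mass G \<rho> p (\<lambda>i s. left_shift_fun G t u i s - g i s) = Lp_mass G \<rho> p (\<lambda>i s. gE i s - g i s)"
        by (rule Lp_mass_cong_AE) (auto intro!: AE_I2 simp: Tu)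
      with gEg have "Lp_rel G \<rho> p `` {left_shift_fun G t u} \<in> V" by (intro q(2)[OF TuL]) simp
      then have "left_shift G \<rho> p t (Lp_rel G \<rho> p `` {u}) \<in> V"
        by (simp add: left_shift_class[OF u TuL t(1)])
      then show "t \<in> return_set (left_shift G \<rho> p) U V"
        using t(1) uU by (auto simp: return_set_def)
    qed
  qed (use K \<epsilon> d in auto)
qed

text \<open>The ball of the uniform radius r around the indicator of K is a legitimate open set for
  recurrence. All its return times beyond N + 1 are small times, and upward closure of the family
  finishes.\<close>

lemma recurrent_small_times:
  assumes F: "furstenberg_family \<F>" "finite_invariant \<F>"
    and rec: "F_recurrent \<F> (Lp_topology G \<rho> p :: ('i \<Rightarrow> real \<Rightarrow> 'k::{real_normed_field, euclidean_space}) set topology) (left_shift G \<rho> p)"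
    and K: "finite K" "K \<noteq> {}" "K \<subseteq> arcs G" and \<epsilon>: "0 < \<epsilon>" and \<alpha>: "0 < \<alpha>" "\<alpha> < 1"
  shows "small_times G \<rho> p K \<epsilon> \<alpha> \<in> \<F>"
proof -
  let ?f = "indicator_family K :: 'i \<Rightarrow> real \<Rightarrow> 'k"
  obtain r where r: "0 < r" "\<And>t (u :: 'i \<Rightarrow> real \<Rightarrow> 'k). 0 \<le> t \<Longrightarrow> u \<in> Lp_fun G \<rho> p \<Longrightarrow> left_shift_fun G t u \<in> Lp_fun G \<rho> p \<Longrightarrow>
      (\<And>i s. i \<in> K \<Longrightarrow> s \<in> {0..<1} \<Longrightarrow> succ_arcs G (shift_n t s) i \<inter> K = {}) \<Longrightarrow>
      Lp_mass G \<rho> p (\<lambda>i s. u i s - indicator_family K i s) < ennreal r \<Longrightarrow>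
      Lp_mass G \<rho> p (\<lambda>i s. left_shift_fun G t u i s - indicator_family K i s) < ennreal r \<Longrightarrow>
      t \<in> small_times G \<rho> p K \<epsilon> \<alpha>"
    using recurrence_small_times[OF K \<epsilon> \<alpha>, where 'k = 'k] by blast
  have f: "?f \<in> Lp_fun G \<rho> p" by (rule indicator_family_Lp[OF K(1,3)])
  obtain U where U: "openin (Lp_topology G \<rho> p) U" "Lp_rel G \<rho> p `` {?f} \<in> U" "U \<subseteq> Lp_space G \<rho> p"
    "\<And>X g. X \<in> U \<Longrightarrow> g \<in> X \<Longrightarrow> Lp_mass G \<rho> p (\<lambda>i s. g i s - ?f i s) < ennreal r"
    using Lp_topology_ball[OF f r(1)] by blast
  obtain N where N: "\<And>n i. n \<ge> N \<Longrightarrow> i \<in> arcs G \<Longrightarrow> succ_arcs G n i \<inter> K = {}"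
    using succ_arcs_avoid_finite[OF tree rooted K(1,3)] by blast
  have "return_set (left_shift G \<rho> p) U U \<in> \<F>"
    using rec U(1,2) by (auto simp: F_recurrent_def)
  then have "return_set (left_shift G \<rho> p) U U \<inter> {real N + 1<..} \<in> \<F>"
    using F(2) by (auto simp: finite_invariant_def)
  moreover have "return_set (left_shift G \<rho> p) U U \<inter> {real N + 1<..} \<subseteq> small_times G \<rho> p K \<epsilon> \<alpha>"
  proof
    fix t assume "t \<in> return_set (left_shift G \<rho> p) U U \<inter> {real N + 1<..}"
    then obtain X where t: "0 \<le> t" "real N \<le> t" and X: "X \<in> U" "left_shift G \<rho> p t X \<in> U"
      by (auto simp: return_set_def)
    then have XL: "X \<in> Lp_space G \<rho> p" "left_shift G \<rho> p t X \<in> Lp_space G \<rho> p" using U(3) by auto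
    obtain u where u: "u \<in> X" "left_shift_fun G t u \<in> left_shift G \<rho> p t X"
      using left_shift_rep[OF XL(2)] by blast
    show "t \<in> small_times G \<rho> p K \<epsilon> \<alpha>"
    proof (rule r(2)[OF t(1)])
      show "u \<in> Lp_fun G \<rho> p" "left_shift_fun G t u \<in> Lp_fun G \<rho> p"
        using Lp_spaceD(2)[OF XL(1) u(1)] Lp_spaceD(2)[OF XL(2) u(2)] .
      show "succ_arcs G (shift_n t s) i \<inter> K = {}" if "i \<in> K" "s \<in> {0..<1}" for i s
        using N[OF shift_n_ge[OF t(2)]] that K by auto
    qed (use U(4)[OF X(1) u(1)] U(4)[OF X(2) u(2)] in auto)
  qed
  moreover have "small_times G \<rho> p K \<epsilon> \<alpha> \<subseteq> {0..}" by (auto simp: small_times_def)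
  ultimately show ?thesis using F(1) unfolding furstenberg_family_def by blast
qed

end

theorem theorem3p3:
  fixes G :: "('v, 'i) pre_digraph"
    and \<rho> :: "'i \<Rightarrow> real \<Rightarrow> real"
    and p :: real
    and \<F> :: "real set set"
    and X :: "('i \<Rightarrow> real \<Rightarrow> 'k::{real_normed_field, euclidean_space}) set topology"
    and T :: "real \<Rightarrow> ('i \<Rightarrow> real \<Rightarrow> 'k) set \<Rightarrow> ('i \<Rightarrow> real \<Rightarrow> 'k) set"
  defines "X \<equiv> Lp_topology G \<rho> p"
    and "T \<equiv> left_shift G \<rho> p"
  assumes "directed_tree G" and "rooted G" and "leafless G"
    and "1 < p"
    and "is_weight G \<rho>" and "admissible G \<rho> p"
    and "furstenberg_family \<F>" and "proper_family \<F>" and "finite_invariant \<F>"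
  shows "(F_transitive \<F> X T \<longleftrightarrow>
           (\<forall>K \<epsilon> \<alpha>. finite K \<and> K \<noteq> {} \<and> K \<subseteq> arcs G \<and> 0 < \<epsilon> \<and> 0 < \<alpha> \<and> \<alpha> < 1 \<longrightarrow>
              small_times G \<rho> p K \<epsilon> \<alpha> \<in> \<F>))
       \<and> ((\<forall>K \<epsilon> \<alpha>. finite K \<and> K \<noteq> {} \<and> K \<subseteq> arcs G \<and> 0 < \<epsilon> \<and> 0 < \<alpha> \<and> \<alpha> < 1 \<longrightarrow>
              small_times G \<rho> p K \<epsilon> \<alpha> \<in> \<F>) \<longleftrightarrow>
           F_recurrent \<F> X T)"
proof -
  interpret admissible_tree G \<rho> p
    using assms by unfold_locales auto
  let ?small = "\<forall>K \<epsilon> \<alpha>. finite K \<and> K \<noteq> {} \<and> K \<subseteq> arcs G \<and> 0 < \<epsilon> \<and> 0 < \<alpha> \<and> \<alpha> < 1 \<longrightarrow>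
              small_times G \<rho> p K \<epsilon> \<alpha> \<in> \<F>"
  \<comment> \<open>The implications form the cycle (ii), (i), (iii), (ii).\<close>
  have 1: "F_transitive \<F> X T" if small: ?small
    unfolding F_transitive_def
  proof (intro allI impI, elim conjE)
    fix U V assume "openin X U" "U \<noteq> {}" "openin X V" "V \<noteq> {}"
    then obtain K \<epsilon> \<alpha> R where K: "finite K" "K \<noteq> {}" "K \<subseteq> arcs G" "0 < \<epsilon>" "0 < \<alpha>" "\<alpha> < 1" "0 < R"
      and sub: "small_times G \<rho> p K \<epsilon> \<alpha> \<inter> {R<..} \<subseteq> return_set T U V"
      unfolding assms(1,2) by (rule small_times_subset_return_set)
    have "small_times G \<rho> p K \<epsilon> \<alpha> \<inter> {R<..} \<in> \<F>"
      using small K \<open>finite_invariant \<F>\<close> by (simp add: finite_invariant_def)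
    moreover have "return_set T U V \<subseteq> {0..}" by (auto simp: return_set_def)
    ultimately show "return_set T U V \<in> \<F>"
      using sub \<open>furstenberg_family \<F>\<close> unfolding furstenberg_family_def by blast
  qed
  have 2: "F_recurrent \<F> X T" if "F_transitive \<F> X T"
    using that by (simp add: F_transitive_def F_recurrent_def)
  have 3: ?small if "F_recurrent \<F> X T"
    using recurrent_small_times[OF \<open>furstenberg_family \<F>\<close> \<open>finite_invariant \<F>\<close> that[unfolded assms(1,2)]]
    by blast
  from 1 2 3 show ?thesis by blast
qed

end
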